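(* Let $C>0$ be a constant and $\Sigma$ a deterministic positive semidefinite $d\times d$ matrix. Let $(X_t)_{t\ge 1}$ be random vectors in $\mathbb{R}^d$ with constant conditional mean $\mathbb{E}[X_t\mid\mathcal{F}_{t-1}]=\mu$ for all $t\ge 1$, satisfying for every $t\ge 1$ $$\big\|\langle\theta,X_t-\mathbb{E}[X_t\mid\mathcal{F}_{t-1}]\rangle\big\|_{\Phi_1}\le C\sqrt{\langle\theta,\Sigma\theta\rangle}\quad\text{for all }\theta\in\mathbb{R}^d,$$ where $\|\cdot\|_{\Phi_1}$ is the 1-Orlicz norm conditional on $\mathcal{F}_{t-1}$. Let $(\lambda_t)_{t\ge 1}$ be a predictable sequence taking values in $(0,1)$ and let $\alpha\in(0,1)$. Then with probability at least $1-\alpha$, simultaneously for all $t\geq 1$, $$\left\|\frac{\sum_{i\leq t}\lambda_i X_i}{\sum_{i\leq t}\lambda_i} - \mu\right\| \leq \frac{2C\, h_\Sigma(1)\sum_{i\leq t}\lambda_i^2 + 4C\, h_\Sigma(\log(2/\alpha))}{\sum_{i\leq t}\lambda_i}.$$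
   Context: $\mathcal{F}_t=\sigma(X_1,\dots,X_t)$ ($\mathcal{F}_0$ trivial); $(\lambda_t)$ is predictable if $\lambda_t$ is $\mathcal{F}_{t-1}$-measurable for every $t$. $\|\cdot\|$ is the Euclidean norm for vectors and the operator norm for matrices. The 1-Orlicz norm of a scalar random variable $Y$ is $\|Y\|_{\Phi_1}=\inf\{\epsilon>0:\mathbb{E}\exp(|Y|/\epsilon)\le 2\}$, and its conditional version replaces $\mathbb{E}$ by $\mathbb{E}[\cdot\mid\mathcal{F}_{t-1}]$. For $u>0$, $h_\Sigma(u):=\sqrt{\mathrm{Tr}(\Sigma)u}+u\sqrt{\|\Sigma\|}$. *)

theory Defs
  imports "HOL-Probability.Probability"
begin

definition psd_matrix :: "real^'n^'n \<Rightarrow> bool" where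
  "psd_matrix A \<longleftrightarrow> transpose A = A \<and> (\<forall>x. 0 \<le> x \<bullet> (A *v x))"

(* The library norm on real^'n^'n is the Frobenius norm; the operator norm is onorm. *)
definition h_fun :: "real^'n^'n \<Rightarrow> real \<Rightarrow> real" where
  "h_fun A u = sqrt (trace A * u) + u * sqrt (onorm ((*v) A))"

definition nat_filtration :: "'a measure \<Rightarrow> (nat \<Rightarrow> 'a \<Rightarrow> 'b::topological_space) \<Rightarrow> nat \<Rightarrow> 'a measure" where
  "nat_filtration M X t =
     sigma (space M) (\<Union>i\<in>{1..t}. {X i -` A \<inter> space M | A. A \<in> sets borel})"

definition vec_cond_exp :: "'a measure \<Rightarrow> 'a measure \<Rightarrow> ('a \<Rightarrow> real^'n) \<Rightarrow> 'a \<Rightarrow> real^'n" where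
  "vec_cond_exp M G X \<omega> = (\<chi> k. real_cond_exp M G (\<lambda>x. X x $ k) \<omega>)"

(* Each conditional expectation is only determined up to a null set depending on e, so a pointwise
   infimum over all real e > 0 would depend on the chosen versions. Almost surely the conditional
   expectation is antitone along rational e, so the infimum over rational e equals almost surely
   the infimum over all real e taken with versions that are antitone in e; see
   AE_cond_orlicz1_le_iff. The value is infinity if no e qualifies. *)
definition cond_orlicz1 :: "'a measure \<Rightarrow> 'a measure \<Rightarrow> ('a \<Rightarrow> real) \<Rightarrow> 'a \<Rightarrow> ennreal" where
  "cond_orlicz1 M G Y \<omega> =
     Inf {ennreal e | e. e \<in> \<rat> \<and> 0 < e \<and> nn_cond_exp M G (\<lambda>x. ennreal (exp (\<bar>Y x\<bar> / e))) \<omega> \<le> 2}"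

lemma subalgebra_nat_filtration:
  fixes X :: "nat \<Rightarrow> 'a \<Rightarrow> 'b::topological_space"
  assumes "\<And>i. 1 \<le> i \<Longrightarrow> X i \<in> borel_measurable M"
  shows "subalgebra M (nat_filtration M X t)"
proof -
  let ?G = "\<Union>i\<in>{1..t}. {X i -` A \<inter> space M | A. A \<in> sets borel}"
  have "?G \<subseteq> sets M" using assms by (auto intro: measurable_sets)
  moreover have "?G \<subseteq> Pow (space M)" by auto
  ultimately show ?thesis
    unfolding subalgebra_def nat_filtration_def
    by (auto simp: sets_measure_of space_measure_of_conv dest: sets.sigma_sets_subset)
qed

lemma AE_cond_orlicz1_le_iff:
  fixes Y :: "'a \<Rightarrow> real"
  assumes "sigma_finite_subalgebra M G" and [measurable]: "Y \<in> borel_measurable M" and "0 \<le> K"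
  shows "(AE \<omega> in M. cond_orlicz1 M G Y \<omega> \<le> ennreal K) \<longleftrightarrow>
    (\<forall>e>K. AE \<omega> in M. nn_cond_exp M G (\<lambda>x. ennreal (exp (\<bar>Y x\<bar> / e))) \<omega> \<le> 2)"
    (is "?L \<longleftrightarrow> ?R")
proof -
  interpret sigma_finite_subalgebra M G by fact
  define f where "f e = nn_cond_exp M G (\<lambda>x. ennreal (exp (\<bar>Y x\<bar> / e)))" for e
  have mono: "AE \<omega> in M. f e' \<omega> \<le> f e \<omega>" if "0 < e" "e \<le> e'" for e e'
    unfolding f_def using that
    by (intro nn_cond_exp_mono AE_I2) (auto intro!: ennreal_leI divide_left_mono mult_pos_pos)
  show ?thesis
  proof
    assume L: ?L
    show ?R
    proof (intro allI impI)
      fix e assume e: "K < e"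
      have "AE \<omega> in M. \<forall>q\<in>{q\<in>\<rat>. 0 < q \<and> q \<le> e}. f e \<omega> \<le> f q \<omega>"
        by (rule AE_ball_countable') (auto intro: mono countable_subset[OF _ countable_rat])
      with L have "AE \<omega> in M. f e \<omega> \<le> 2"
      proof eventually_elim
        case (elim \<omega>)
        have "cond_orlicz1 M G Y \<omega> < ennreal e"
          using elim(1) e \<open>0 \<le> K\<close> by (auto intro: le_less_trans simp: ennreal_less_iff)
        then obtain q where "q \<in> \<rat>" "0 < q" "f q \<omega> \<le> 2" "ennreal q < ennreal e"
          unfolding cond_orlicz1_def f_def by (auto simp: Inf_less_iff)
        moreover then have "q \<le> e" by (simp add: ennreal_less_iff)
        ultimately show ?case using elim(2) by (auto intro: order_trans)
      qed
      then show "AE \<omega> in M. nn_cond_exp M G (\<lambda>x. ennreal (exp (\<bar>Y x\<bar> / e))) \<omega> \<le> 2"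
        by (simp add: f_def)
    qed
  next
    assume R: ?R
    have "AE \<omega> in M. \<forall>q\<in>{q\<in>\<rat>. K < q}. f q \<omega> \<le> 2"
      using R by (intro AE_ball_countable') (auto simp: f_def intro: countable_subset[OF _ countable_rat])
    then show ?L
    proof eventually_elim
      case (elim \<omega>)
      show ?case
      proof (rule ennreal_le_epsilon)
        fix d :: real assume "0 < d"
        then obtain q where q: "q \<in> \<rat>" "K < q" "q < K + d"
          using Rats_dense_in_real[of K "K + d"] by auto
        have "cond_orlicz1 M G Y \<omega> \<le> ennreal q"
          unfolding cond_orlicz1_def using q elim \<open>0 \<le> K\<close>
          by (intro Inf_lower) (auto simp: f_def)
        also have "\<dots> \<le> ennreal K + ennreal d"
          using q \<open>0 \<le> K\<close> \<open>0 < d\<close> by (simp flip: ennreal_plus)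
        finally show "cond_orlicz1 M G Y \<omega> \<le> ennreal K + ennreal d" .
      qed
    qed
  qed
qed

end

theory Submission
  imports Defs
begin

text \<open>
  Write \<open>S t\<close> for the sum of \<open>lam i *\<^sub>R (X i - \<mu>)\<close> and \<open>V t\<close> for that of \<open>3/4 * (lam i)\<^sup>2\<close>. On the ellipsoid
  \<open>2 C\<^sup>2 (x \<bullet> \<Sigma> x) \<le> 1\<close> the Orlicz condition makes \<open>exp (x \<bullet> S t - V t)\<close> a supermartingale, and so is its
  mixture over \<open>x\<close> with respect to a centred Gaussian cut off to the ellipsoid. By Ville's inequality
  the mixture stays below \<open>1 / \<alpha>\<close> with probability at least \<open>1 - \<alpha>\<close>. Recentring the Gaussian at a vector of
  length \<open>\<gamma>\<close> in the direction of \<open>S t\<close>, and keeping only the part (at least half of its mass) where the \<open>\<Sigma>\<close>-norm is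
  at most \<open>sqrt 2\<close> times its root mean square, bounds the mixture from below by
  \<open>exp (\<gamma> * norm (S t) - V t - ln (2 / \<alpha>)) / 2\<close>. No dimension enters besides the trace of \<open>\<Sigma>\<close>.
\<close>

section \<open>Isotropic Gaussian densities\<close>

text \<open>The density of the centred Gaussian with covariance \<open>s\<^sup>2\<close> times the
  identity. The product over \<open>Basis\<close> lets integrals factor into one-dimensional ones;
  \<open>gauss_density_eq\<close> recovers the form in terms of the norm.\<close>

definition gauss_density :: "real \<Rightarrow> 'a::euclidean_space \<Rightarrow> real" where
  "gauss_density s x = (\<Prod>b\<in>Basis. normal_density 0 s (x \<bullet> b))"

lemma gauss_density_nonneg [simp]: "0 \<le> gauss_density s x"
  by (simp add: gauss_density_def prod_nonneg)

lemma borel_measurable_gauss_density [measurable]: "gauss_density s \<in> borel_measurable borel"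
  by (simp add: gauss_density_def[abs_def])

lemma gauss_density_eq:
  fixes x :: "'a::euclidean_space"
  shows "gauss_density s x = (1 / sqrt (2 * pi * s\<^sup>2)) ^ DIM('a) * exp (- (norm x)\<^sup>2 / (2 * s\<^sup>2))"
proof -
  have "(norm x)\<^sup>2 = (\<Sum>b\<in>Basis. (x \<bullet> b)\<^sup>2)"
    by (subst power2_norm_eq_inner, subst euclidean_inner) (simp add: power2_eq_square)
  then show ?thesis
    by (simp add: gauss_density_def normal_density_def prod.distrib prod_dividef power_divide
        sum_negf sum_divide_distrib flip: exp_sum)
qed

lemma gauss_density_uminus [simp]: "gauss_density s (- x) = gauss_density s x"
  by (simp add: gauss_density_eq)

text \<open>Expand the squared norm. This is the Cameron-Martin factor: recentring the Gaussian
  costs a linear term and a constant in the exponent.\<close>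

lemma gauss_density_shift:
  "gauss_density s (u + x) = gauss_density s x * exp (- (u \<bullet> x) / s\<^sup>2 - (norm u)\<^sup>2 / (2 * s\<^sup>2))"
proof -
  have "(norm (u + x))\<^sup>2 = (norm x)\<^sup>2 + 2 * (u \<bullet> x) + (norm u)\<^sup>2"
    by (simp add: power2_norm_eq_inner inner_add inner_commute)
  then have "- (norm (u + x))\<^sup>2 / (2 * s\<^sup>2) =
      - (norm x)\<^sup>2 / (2 * s\<^sup>2) + (- (u \<bullet> x) / s\<^sup>2 - (norm u)\<^sup>2 / (2 * s\<^sup>2))"
    by (simp add: add_divide_distrib diff_divide_distrib)
  then show ?thesis
    unfolding gauss_density_eq by (simp only: exp_add mult.assoc)
qed

lemma nn_integral_gauss_density:
  assumes "0 < s"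
  shows "(\<integral>\<^sup>+x. ennreal (gauss_density s x) \<partial>(lborel :: 'a::euclidean_space measure)) = 1"
proof -
  have "(\<integral>\<^sup>+x. ennreal (gauss_density s x) \<partial>(lborel :: 'a measure))
      = (\<integral>\<^sup>+x. (\<Prod>b\<in>Basis. ennreal (normal_density 0 s (x \<bullet> b))) \<partial>(lborel :: 'a measure))"
    by (simp add: gauss_density_def prod_ennreal)
  also have "\<dots> = (\<Prod>b\<in>(Basis :: 'a set). (\<integral>\<^sup>+x. ennreal (normal_density 0 s x) \<partial>lborel))"
    by (rule nn_integral_lborel_prod) auto
  also have "\<dots> = 1"
    using assms by (simp add: nn_integral_eq_integral)
  finally show ?thesis .
qed

section \<open>Second moments and quadratic forms under the Gaussian\<close>

text \<open>The integrand is a product over coordinates: coordinate \<open>i\<close> contributes the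
  one-dimensional variance, every other coordinate a total mass of one.\<close>

lemma gauss_density_second_moment_diag:
  fixes i :: "'a::euclidean_space"
  assumes "0 < s" "i \<in> Basis"
  shows "has_bochner_integral lborel (\<lambda>x. gauss_density s x * (x \<bullet> i)\<^sup>2) (s\<^sup>2)"
proof (rule has_bochner_integral_nn_integral)
  let ?f = "\<lambda>b y :: real. ennreal (normal_density 0 s y * (if b = i then y\<^sup>2 else 1))"
  have "(\<integral>\<^sup>+x. ennreal (gauss_density s x * (x \<bullet> i)\<^sup>2) \<partial>lborel)
      = (\<integral>\<^sup>+x. (\<Prod>b\<in>Basis. ?f b (x \<bullet> b)) \<partial>lborel)"
  proof (rule nn_integral_cong)
    fix x :: 'a
    have "gauss_density s x * (x \<bullet> i)\<^sup>2
        = (\<Prod>b\<in>Basis. normal_density 0 s (x \<bullet> b) * (if b = i then (x \<bullet> b)\<^sup>2 else 1))"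
      using assms(2) by (simp add: gauss_density_def prod.distrib prod.delta)
    then show "ennreal (gauss_density s x * (x \<bullet> i)\<^sup>2) = (\<Prod>b\<in>Basis. ?f b (x \<bullet> b))"
      by (simp add: prod_ennreal)
  qed
  also have "\<dots> = (\<Prod>b\<in>Basis. (\<integral>\<^sup>+y. ?f b y \<partial>lborel))"
    by (rule nn_integral_lborel_prod) auto
  also have "\<dots> = (\<Prod>b\<in>Basis. if b = i then ennreal (s\<^sup>2) else 1)"
  proof (rule prod.cong[OF refl])
    fix b :: 'a
    have "(\<integral>\<^sup>+y. ennreal (normal_density 0 s y * y\<^sup>2) \<partial>lborel) = ennreal (s\<^sup>2)"
      using normal_moment_even[OF assms(1), of 0 1] assms(1)
      by (subst nn_integral_eq_integral) (auto simp: has_bochner_integral_iff power2_eq_square)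
    then show "(\<integral>\<^sup>+y. ?f b y \<partial>lborel) = (if b = i then ennreal (s\<^sup>2) else 1)"
      using assms(1) by (simp add: nn_integral_eq_integral)
  qed
  also have "\<dots> = ennreal (s\<^sup>2)"
    using assms(2) by (simp add: prod.delta)
  finally show "(\<integral>\<^sup>+x. ennreal (gauss_density s x * (x \<bullet> i)\<^sup>2) \<partial>lborel) = ennreal (s\<^sup>2)" .
qed auto

text \<open>Reflecting coordinate \<open>i\<close> preserves Lebesgue measure and the density but
  changes the sign of the integrand, so the integral equals its own negative.\<close>

lemma gauss_density_second_moment_off_diag:
  fixes i j :: "'a::euclidean_space"
  assumes "0 < s" "i \<in> Basis" "j \<in> Basis" "i \<noteq> j"
  shows "has_bochner_integral lborel (\<lambda>x. gauss_density s x * ((x \<bullet> i) * (x \<bullet> j))) 0"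
proof -
  let ?g = "\<lambda>x. gauss_density s x * ((x \<bullet> i) * (x \<bullet> j))"
  have int: "integrable lborel ?g"
  proof (rule Bochner_Integration.integrable_bound)
    show "integrable lborel (\<lambda>x. gauss_density s x * (x \<bullet> i)\<^sup>2 + gauss_density s x * (x \<bullet> j)\<^sup>2)"
      using gauss_density_second_moment_diag[OF assms(1)] assms(2,3)
      by (intro Bochner_Integration.integrable_add) (auto simp: has_bochner_integral_iff)
    \<comment> \<open>Integrability by domination: a product of two coordinates is at most the sum
      of their squares.\<close>
    have "\<bar>x * y\<bar> \<le> \<bar>x\<^sup>2 + y\<^sup>2\<bar>" for x y :: real
      using sum_squares_bound[of x y] sum_squares_bound[of x "- y"] by (auto simp: abs_if mult_nonneg_nonneg)
    then show "AE x in lborel. norm (?g x) \<le>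
        norm (gauss_density s x * (x \<bullet> i)\<^sup>2 + gauss_density s x * (x \<bullet> j)\<^sup>2)"
      by (auto simp: abs_mult simp flip: distrib_left intro!: mult_left_mono)
  qed auto
  let ?c = "\<lambda>b :: 'a. if b = i then - 1 else 1 :: real"
  define T where "T x = (\<Sum>b\<in>Basis. (?c b * (x \<bullet> b)) *\<^sub>R b)" for x :: 'a
  have T_inner: "T x \<bullet> b = ?c b * (x \<bullet> b)" if "b \<in> Basis" for x b
    using that by (simp add: T_def inner_sum_left inner_Basis if_distrib[of "\<lambda>z. _ * z"] sum.delta cong: if_cong)
  have "lborel = density (distr lborel borel T) (\<lambda>_. (\<Prod>b\<in>Basis. \<bar>?c b\<bar>))"
    using lborel_affine_euclidean[of ?c 0] by (simp add: T_def[abs_def])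
  also have "(\<Prod>b\<in>Basis. \<bar>?c b\<bar>) = 1"
    by (rule prod.neutral) auto
  finally have "lborel = distr lborel borel T"
    by (simp add: density_1)
  moreover have [measurable]: "T \<in> borel_measurable borel"
    by (simp add: T_def[abs_def])
  moreover have "(\<integral>x. ?g x \<partial>distr lborel borel T) = (\<integral>x. ?g (T x) \<partial>lborel)"
    by (rule integral_distr) auto
  ultimately have "(\<integral>x. ?g x \<partial>lborel) = (\<integral>x. ?g (T x) \<partial>lborel)"
    by simp
  also have "(\<lambda>x. ?g (T x)) = (\<lambda>x. - ?g x)"
  proof
    fix x
    have "gauss_density s (T x) = gauss_density s x"
      unfolding gauss_density_def by (rule prod.cong) (auto simp: T_inner normal_density_def)
    then show "?g (T x) = - ?g x"
      using assms by (simp add: T_inner)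
  qed
  finally show ?thesis
    using int by (simp add: has_bochner_integral_iff)
qed

text \<open>Expanding in coordinates, only the diagonal terms survive; the sum on the right is the
  trace of \<open>f\<close>.\<close>

lemma gauss_density_quadratic_form:
  fixes f :: "'a::euclidean_space \<Rightarrow> 'a"
  assumes "0 < s" "linear f"
  shows "has_bochner_integral lborel (\<lambda>x. gauss_density s x * (x \<bullet> f x)) (s\<^sup>2 * (\<Sum>b\<in>Basis. b \<bullet> f b))"
proof -
  have "gauss_density s x * (x \<bullet> f x) =
      (\<Sum>i\<in>Basis. \<Sum>j\<in>Basis. (i \<bullet> f j) * (gauss_density s x * ((x \<bullet> i) * (x \<bullet> j))))" for x
  proof -
    have "f x = (\<Sum>j\<in>Basis. (x \<bullet> j) *\<^sub>R f j)"
      using assms(2) by (metis (mono_tags, lifting) euclidean_representation linear_sum linear_scale sum.cong)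
    then have "i \<bullet> f x = (\<Sum>j\<in>Basis. (x \<bullet> j) * (i \<bullet> f j))" for i
      by (simp add: inner_sum_right)
    then have "x \<bullet> f x = (\<Sum>i\<in>Basis. (x \<bullet> i) * (\<Sum>j\<in>Basis. (x \<bullet> j) * (i \<bullet> f j)))"
      by (subst euclidean_inner) (simp add: inner_commute[of "f x"])
    then show ?thesis
      by (simp add: sum_distrib_left mult_ac)
  qed
  moreover have "has_bochner_integral lborel
      (\<lambda>x. \<Sum>i\<in>Basis. \<Sum>j\<in>Basis. (i \<bullet> f j) * (gauss_density s x * ((x \<bullet> i) * (x \<bullet> j))))
      (\<Sum>i\<in>Basis. \<Sum>j\<in>Basis. (i \<bullet> f j) * (if i = j then s\<^sup>2 else 0))"
    using gauss_density_second_moment_diag[OF assms(1)]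
      gauss_density_second_moment_off_diag[OF assms(1)]
    by (intro has_bochner_integral_sum has_bochner_integral_mult_right) (auto simp: power2_eq_square)
  moreover have "(\<Sum>i\<in>Basis. \<Sum>j\<in>Basis. (i \<bullet> f j) * (if i = j then s\<^sup>2 else 0)) = s\<^sup>2 * (\<Sum>b\<in>Basis. b \<bullet> f b)"
    by (simp add: if_distrib[of "\<lambda>z. _ * z"] sum.delta sum_distrib_left mult.commute cong: if_cong)
  ultimately show ?thesis by simp
qed

section \<open>Truncated Gaussians and lower bounds for their exponential mixtures\<close>

text \<open>Markov's inequality at twice the bound \<open>m\<close> on the mean: the complement has
  mass at most one half.\<close>

lemma gauss_quadratic_form_small:
  fixes f :: "'a::euclidean_space \<Rightarrow> 'a"
  assumes "0 < s" "linear f" and nonneg: "\<And>x. 0 \<le> x \<bullet> f x"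
    and m: "s\<^sup>2 * (\<Sum>b\<in>Basis. b \<bullet> f b) \<le> m"
  shows "ennreal (1/2) \<le> (\<integral>\<^sup>+x. ennreal (gauss_density s x) * indicator {x. x \<bullet> f x \<le> 2 * m} x \<partial>lborel)"
proof -
  have [measurable]: "f \<in> borel_measurable borel"
    using assms(2) by (intro borel_measurable_continuous_onI linear_continuous_on linear_conv_bounded_linear[THEN iffD1])
  have "0 \<le> s\<^sup>2 * (\<Sum>b\<in>Basis. b \<bullet> f b)"
    by (simp add: nonneg sum_nonneg)
  then have "0 \<le> m" using m by simp
  have I: "(\<integral>\<^sup>+x. ennreal (gauss_density s x * (x \<bullet> f x)) \<partial>lborel) = ennreal (s\<^sup>2 * (\<Sum>b\<in>Basis. b \<bullet> f b))"
    using gauss_density_quadratic_form[OF assms(1,2)]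
    by (subst nn_integral_eq_integral) (auto simp: has_bochner_integral_iff nonneg)
  define A where "A = (\<integral>\<^sup>+x. ennreal (gauss_density s x) * indicator {x. x \<bullet> f x \<le> 2 * m} x \<partial>lborel)"
  define B where "B = (\<integral>\<^sup>+x. ennreal (gauss_density s x) * indicator {x. \<not> x \<bullet> f x \<le> 2 * m} x \<partial>lborel)"
  have AB: "A + B = 1"
    unfolding A_def B_def
    by (subst nn_integral_add[symmetric], measurable)
       (subst nn_integral_gauss_density[OF assms(1), symmetric],
         auto intro!: nn_integral_cong split: split_indicator)
  have "B \<le> ennreal (1/2)"
  \<comment> \<open>Markov's inequality divides by \<open>m\<close>. If \<open>m = 0\<close>, the
    form integrates to zero, so the density times the indicator of a positive form vanishes almost
    everywhere.\<close>
  proof (cases "m = 0")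
    case True
    then have "(\<integral>\<^sup>+x. ennreal (gauss_density s x * (x \<bullet> f x)) \<partial>lborel) = 0"
      using I m by (simp add: ennreal_neg)
    then have "AE x in lborel. ennreal (gauss_density s x * (x \<bullet> f x)) = 0"
      by (subst (asm) nn_integral_0_iff_AE) auto
    then have "AE x in lborel. ennreal (gauss_density s x) * indicator {x. \<not> x \<bullet> f x \<le> 2 * m} x = 0"
    proof eventually_elim
      case (elim x)
      then have "gauss_density s x * (x \<bullet> f x) \<le> 0"
        by (simp only: ennreal_eq_0_iff)
      then show ?case
        using True nonneg[of x] gauss_density_nonneg[of s x]
        by (auto simp: mult_le_0_iff ennreal_neg split: split_indicator)
    qed
    then have "B = 0"
      unfolding B_def by (subst nn_integral_0_iff_AE) auto
    then show ?thesis by simp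
  next
    case False
    then have "0 < m" using \<open>0 \<le> m\<close> by simp
    have "B \<le> (\<integral>\<^sup>+x. ennreal (1 / (2 * m)) * ennreal (gauss_density s x * (x \<bullet> f x)) \<partial>lborel)"
      unfolding B_def
    proof (rule nn_integral_mono)
      fix x :: 'a
      have "ennreal (gauss_density s x) \<le> ennreal (1 / (2 * m)) * ennreal (gauss_density s x * (x \<bullet> f x))"
        if "\<not> x \<bullet> f x \<le> 2 * m"
        using that \<open>0 < m\<close> nonneg mult_left_mono[of "2 * m" "x \<bullet> f x" "gauss_density s x"]
        by (auto simp flip: ennreal_mult simp: field_simps intro!: ennreal_leI)
      then show "ennreal (gauss_density s x) * indicator {x. \<not> x \<bullet> f x \<le> 2 * m} x
          \<le> ennreal (1 / (2 * m)) * ennreal (gauss_density s x * (x \<bullet> f x))"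
        by (auto split: split_indicator)
    qed
    also have "\<dots> = ennreal (1 / (2 * m)) * ennreal (s\<^sup>2 * (\<Sum>b\<in>Basis. b \<bullet> f b))"
      by (subst nn_integral_cmult) (auto simp: I)
    also have "\<dots> \<le> ennreal (1 / (2 * m)) * ennreal m"
      by (intro mult_left_mono ennreal_leI m) auto
    also have "\<dots> = ennreal (1/2)"
      using \<open>0 < m\<close> by (simp flip: ennreal_mult)
    finally show ?thesis .
  qed
  then have "ennreal (1/2) + ennreal (1/2) \<le> A + ennreal (1/2)"
    using AB by (metis add_left_mono ennreal_1 ennreal_plus field_sum_of_halves zero_le_divide_1_iff zero_le_numeral)
  then show ?thesis
    unfolding A_def by (simp add: ennreal_add_left_cancel_le add.commute)
qed

text \<open>Symmetrising under \<open>x \<mapsto> - x\<close> replaces the exponential by a hyperbolic cosine.\<close>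

lemma gauss_symmetric_exp_ge:
  fixes v :: "'a::euclidean_space"
  assumes B [measurable]: "B \<in> sets borel" and sym: "\<And>x. x \<in> B \<Longrightarrow> - x \<in> B"
  shows "(\<integral>\<^sup>+x. ennreal (gauss_density s x) * indicator B x \<partial>lborel)
    \<le> (\<integral>\<^sup>+x. ennreal (gauss_density s x * exp (v \<bullet> x)) * indicator B x \<partial>lborel)"
proof -
  let ?g = "\<lambda>v x. ennreal (gauss_density s x * exp (v \<bullet> x)) * indicator B x"
  have B_uminus: "indicator B (- x) = (indicator B x :: ennreal)" for x
    using sym[of x] sym[of "- x"] by (auto split: split_indicator)
  have "(lborel :: 'a measure) = distr lborel borel uminus"
    using lborel_affine[of "- 1" "0 :: 'a"] by (simp add: density_1)
  then have "(\<integral>\<^sup>+x. ?g v x \<partial>lborel) = (\<integral>\<^sup>+x. ?g v x \<partial>distr lborel borel uminus)"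
    by simp
  also have "\<dots> = (\<integral>\<^sup>+x. ?g (- v) x \<partial>lborel)"
    by (subst nn_integral_distr) (auto simp: B_uminus)
  finally have flip: "(\<integral>\<^sup>+x. ?g v x \<partial>lborel) = (\<integral>\<^sup>+x. ?g (- v) x \<partial>lborel)" .
  have "2 * (\<integral>\<^sup>+x. ennreal (gauss_density s x) * indicator B x \<partial>lborel)
      = (\<integral>\<^sup>+x. 2 * (ennreal (gauss_density s x) * indicator B x) \<partial>lborel)"
    by (simp add: nn_integral_cmult)
  also have "\<dots> \<le> (\<integral>\<^sup>+x. ?g v x + ?g (- v) x \<partial>lborel)"
  proof (rule nn_integral_mono)
    fix x :: 'a
    \<comment> \<open>Adding \<open>1 + c \<le> exp c\<close> for \<open>c = v \<bullet> x\<close>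
      and for its negative bounds the sum of the two exponentials below by 2.\<close>
    have "2 * gauss_density s x \<le> gauss_density s x * exp (v \<bullet> x) + gauss_density s x * exp (- (v \<bullet> x))"
      using mult_left_mono[of 2 "exp (v \<bullet> x) + exp (- (v \<bullet> x))" "gauss_density s x"]
        exp_ge_add_one_self[of "v \<bullet> x"] exp_ge_add_one_self[of "- (v \<bullet> x)"]
      by (simp add: distrib_left mult.commute)
    then have "ennreal (2 * gauss_density s x)
        \<le> ennreal (gauss_density s x * exp (v \<bullet> x)) + ennreal (gauss_density s x * exp (- (v \<bullet> x)))"
      by (simp flip: ennreal_plus)
    then show "2 * (ennreal (gauss_density s x) * indicator B x) \<le> ?g v x + ?g (- v) x"
      by (auto simp: ennreal_mult split: split_indicator)
  qed
  also have "\<dots> = (\<integral>\<^sup>+x. ?g v x \<partial>lborel) + (\<integral>\<^sup>+x. ?g (- v) x \<partial>lborel)"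
    by (rule nn_integral_add) auto
  also have "\<dots> = 2 * (\<integral>\<^sup>+x. ?g v x \<partial>lborel)"
    by (simp only: flip mult_2)
  finally show ?thesis
    by (subst (asm) ennreal_mult_le_mult_iff) auto
qed

text \<open>Substitute \<open>w + x\<close> for \<open>x\<close> and restrict to the symmetric set
  \<open>B\<close>, which has mass at least one half. The shift costs
  \<open>(norm w)\<^sup>2 / (2 * s\<^sup>2)\<close>, and the remaining linear tilt can only help by
  symmetry. The condition on \<open>r\<close> ensures that the translate of \<open>B\<close> by
  \<open>w\<close> stays inside the cut-off region.\<close>

lemma gauss_mixture_exp_ge:
  fixes f :: "'a::euclidean_space \<Rightarrow> 'a"
  assumes "0 < s" and f: "linear f" and nonneg: "\<And>x. 0 \<le> x \<bullet> f x"
    and r: "2 * (w \<bullet> f w) + 4 * (s\<^sup>2 * (\<Sum>b\<in>Basis. b \<bullet> f b)) \<le> r"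
  shows "ennreal (exp (w \<bullet> z - v - (norm w)\<^sup>2 / (2 * s\<^sup>2)) / 2)
    \<le> (\<integral>\<^sup>+x. ennreal (gauss_density s x) * indicator {x. x \<bullet> f x \<le> r} x * ennreal (exp (x \<bullet> z - v)) \<partial>lborel)"
proof -
  have [measurable]: "f \<in> borel_measurable borel"
    using f by (intro borel_measurable_continuous_onI linear_continuous_on linear_conv_bounded_linear[THEN iffD1])
  define m where "m = s\<^sup>2 * (\<Sum>b\<in>Basis. b \<bullet> f b)"
  define B where "B = {x. x \<bullet> f x \<le> 2 * m}"
  define k where "k = exp (w \<bullet> z - v - (norm w)\<^sup>2 / (2 * s\<^sup>2))"
  \<comment> \<open>The whole tilt linear in \<open>x\<close> after the shift: \<open>z\<close>
    comes from the integrand, the other term from the Gaussian density.\<close>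
  define y where "y = z - (1 / s\<^sup>2) *\<^sub>R w"
  let ?h = "\<lambda>x. ennreal (gauss_density s x) * indicator {x. x \<bullet> f x \<le> r} x * ennreal (exp (x \<bullet> z - v))"
  have [measurable]: "B \<in> sets borel"
    by (simp add: B_def)
  have small: "(w + x) \<bullet> f (w + x) \<le> r" if "x \<in> B" for x
  proof -
    \<comment> \<open>Parallelogram identity; the nonnegative term at \<open>w - x\<close> is then
      dropped.\<close>
    have "(w + x) \<bullet> f (w + x) + (w - x) \<bullet> f (w - x) = 2 * (w \<bullet> f w) + 2 * (x \<bullet> f x)"
      by (simp add: linear_add[OF f] linear_diff[OF f] inner_add inner_diff)
    then show ?thesis
      using nonneg[of "w - x"] that r by (simp add: B_def m_def)
  qed
  have "ennreal (k / 2) = ennreal k * ennreal (1/2)"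
    by (subst ennreal_mult[symmetric]) (auto simp: k_def)
  also have "\<dots> \<le> ennreal k * (\<integral>\<^sup>+x. ennreal (gauss_density s x) * indicator B x \<partial>lborel)"
    unfolding B_def using assms
    by (intro mult_left_mono gauss_quadratic_form_small) (auto simp: m_def)
  also have "\<dots> \<le> ennreal k * (\<integral>\<^sup>+x. ennreal (gauss_density s x * exp (y \<bullet> x)) * indicator B x \<partial>lborel)"
    by (intro mult_left_mono gauss_symmetric_exp_ge) (auto simp: B_def linear_neg[OF f])
  also have "\<dots> = (\<integral>\<^sup>+x. ennreal k * (ennreal (gauss_density s x * exp (y \<bullet> x)) * indicator B x) \<partial>lborel)"
    by (rule nn_integral_cmult[symmetric]) measurable
  also have "\<dots> \<le> (\<integral>\<^sup>+x. ?h (w + x) \<partial>lborel)"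
  proof (rule nn_integral_mono)
    fix x
    have "(- (w \<bullet> x) / s\<^sup>2 - (norm w)\<^sup>2 / (2 * s\<^sup>2)) + ((w + x) \<bullet> z - v)
        = (w \<bullet> z - v - (norm w)\<^sup>2 / (2 * s\<^sup>2)) + y \<bullet> x"
    proof -
      have "y \<bullet> x = x \<bullet> z - (w \<bullet> x) / s\<^sup>2"
        by (simp add: y_def inner_diff_left inner_commute[of z x])
      then show ?thesis
        by (simp only: inner_add_left minus_divide_left)
    qed
    then have "exp (- (w \<bullet> x) / s\<^sup>2 - (norm w)\<^sup>2 / (2 * s\<^sup>2)) * exp ((w + x) \<bullet> z - v) = k * exp (y \<bullet> x)"
      unfolding k_def by (simp only: flip: exp_add)
    then have "gauss_density s (w + x) * exp ((w + x) \<bullet> z - v) = k * (gauss_density s x * exp (y \<bullet> x))"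
      unfolding gauss_density_shift by (simp only: mult_ac)
    then have "ennreal (gauss_density s (w + x)) * ennreal (exp ((w + x) \<bullet> z - v))
        = ennreal k * ennreal (gauss_density s x * exp (y \<bullet> x))"
      by (metis ennreal_mult exp_ge_zero gauss_density_nonneg k_def mult_nonneg_nonneg)
    then show "ennreal k * (ennreal (gauss_density s x * exp (y \<bullet> x)) * indicator B x) \<le> ?h (w + x)"
      using small[of x] by (auto split: split_indicator)
  qed
  also have "\<dots> = (\<integral>\<^sup>+x. ?h x \<partial>distr lborel borel ((+) w))"
    by (rule nn_integral_distr[symmetric]) auto
  also have "\<dots> = (\<integral>\<^sup>+x. ?h x \<partial>lborel)"
    by (simp only: lborel_distr_plus)
  finally show ?thesis
    by (simp only: k_def)
qed

section \<open>Exponential supermartingales\<close>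

text \<open>Compare the exponential series from degree two on: there
  \<open>u ^ (n + 2) \<le> u\<^sup>2\<close>, so a factor \<open>u\<^sup>2\<close> comes
  out.\<close>

lemma exp_le_quadratic_scaling:
  fixes u y :: real
  assumes "0 \<le> u" "u \<le> 1"
  shows "exp (u * y) \<le> 1 + u * y + u\<^sup>2 * (exp \<bar>y\<bar> - 1)"
proof -
  let ?f = "\<lambda>x n. inverse (fact (n + 2)) *\<^sub>R (x ^ (n + 2)) :: real"
  have summ: "summable (?f x)" for x
    by (rule summable_exp_generic[THEN summable_ignore_initial_segment])
  have "(\<Sum>n. ?f (u * y) n) \<le> (\<Sum>n. u\<^sup>2 * ?f \<bar>y\<bar> n)"
  proof (rule suminf_le)
    show "?f (u * y) n \<le> u\<^sup>2 * ?f \<bar>y\<bar> n" for n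
    proof -
      have "u ^ (n + 2) \<le> u\<^sup>2"
        using assms by (intro power_decreasing) auto
      then have "u ^ (n + 2) * \<bar>y\<bar> ^ (n + 2) \<le> u\<^sup>2 * \<bar>y\<bar> ^ (n + 2)"
        by (intro mult_right_mono) auto
      moreover have "(u * y) ^ (n + 2) \<le> \<bar>u * y\<bar> ^ (n + 2)"
        by (metis abs_ge_self power_abs)
      moreover have "\<bar>u * y\<bar> ^ (n + 2) = u ^ (n + 2) * \<bar>y\<bar> ^ (n + 2)"
        using assms(1) by (simp add: abs_mult power_mult_distrib)
      ultimately have "(u * y) ^ (n + 2) \<le> u\<^sup>2 * \<bar>y\<bar> ^ (n + 2)"
        by linarith
      then have "inverse (fact (n + 2)) * (u * y) ^ (n + 2) \<le> inverse (fact (n + 2)) * (u\<^sup>2 * \<bar>y\<bar> ^ (n + 2))"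
        by (rule mult_left_mono) simp
      then show ?thesis
        by (simp only: real_scaleR_def mult.left_commute)
    qed
  qed (intro summ summable_mult)+
  also have "\<dots> = u\<^sup>2 * (\<Sum>n. ?f \<bar>y\<bar> n)"
    by (rule suminf_mult[OF summ])
  \<comment> \<open>The tail of the series is \<open>exp \<bar>y\<bar> - 1 - \<bar>y\<bar>\<close>;
    the term \<open>\<bar>y\<bar>\<close> is given away, leaving only the exponential moment that
    the Orlicz norm controls.\<close>
  also have "\<dots> \<le> u\<^sup>2 * (exp \<bar>y\<bar> - 1)"
    using exp_first_two_terms[of "\<bar>y\<bar>"] by (intro mult_left_mono) auto
  finally show ?thesis
    using exp_first_two_terms[of "u * y"] by simp
qed

text \<open>The conditional expectation of \<open>exp_le_quadratic_scaling\<close>, with the negative parts moved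
  across so that everything takes place in the extended nonnegative reals.\<close>

lemma (in sigma_finite_subalgebra) nn_integral_exp_compensated_le:
  fixes Y lam :: "'a \<Rightarrow> real"
  assumes Y: "integrable M Y" "AE x in M. real_cond_exp M F Y x = 0"
    and e: "0 < e" "AE x in M. nn_cond_exp M F (\<lambda>x. ennreal (exp (\<bar>Y x\<bar> / e))) x \<le> 2"
    and lam [measurable]: "lam \<in> borel_measurable F"
    and lam_nonneg: "\<And>x. x \<in> space M \<Longrightarrow> 0 \<le> lam x"
    and lam_le: "\<And>x. x \<in> space M \<Longrightarrow> lam x * e \<le> 1"
    and H [measurable]: "H \<in> borel_measurable F"
  shows "(\<integral>\<^sup>+x. H x * ennreal (exp (lam x * Y x - (lam x)\<^sup>2 * e\<^sup>2)) \<partial>M) \<le> (\<integral>\<^sup>+x. H x \<partial>M)"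
proof -
  have [measurable]: "Y \<in> borel_measurable M"
    using Y(1) by auto
  have [measurable]: "lam \<in> borel_measurable M" "H \<in> borel_measurable M"
    using measurable_from_subalg[OF subalg] lam H by blast+
  \<comment> \<open>With this scaling \<open>lam x * Y x = u x * (Y x / e)\<close>, and
    \<open>Y x / e\<close> is the variable whose exponential moment is bounded by 2.\<close>
  define u where "u x = lam x * e" for x
  have u [measurable]: "u \<in> borel_measurable F" "u \<in> borel_measurable M"
    by (simp_all add: u_def[abs_def])
  have u01: "0 \<le> u x" "u x \<le> 1" if "x \<in> space M" for x
    using lam_nonneg[OF that] lam_le[OF that] e(1) by (auto simp: u_def)
  let ?E = "\<lambda>x. ennreal (exp (lam x * Y x))"
  let ?Z = "\<lambda>x. ennreal (exp (\<bar>Y x\<bar> / e))"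
  let ?P = "\<lambda>x. ennreal (Y x)" and ?N = "\<lambda>x. ennreal (- Y x)"
  let ?c = "nn_cond_exp M F"
  \<comment> \<open>Finiteness is what permits cancelling these terms in the extended reals.\<close>
  have fin: "AE x in M. ?c ?P x < \<infinity>" "AE x in M. ?c ?N x < \<infinity>"
  proof -
    have *: "AE x in M. ?c f x < \<infinity>" if [measurable]: "f \<in> borel_measurable M" and "(\<integral>\<^sup>+x. f x \<partial>M) < \<infinity>" for f
    proof -
      have "(\<integral>\<^sup>+x. ?c f x \<partial>M) = (\<integral>\<^sup>+x. f x \<partial>M)"
        using nn_cond_exp_intg[of "\<lambda>_. 1" f] by simp
      then have "(\<integral>\<^sup>+x. ?c f x \<partial>M) \<noteq> \<infinity>"
        using that(2) by simp
      then have "AE x in M. ?c f x \<noteq> \<infinity>"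
        by (intro nn_integral_noteq_infinite measurable_from_subalg[OF subalg]) auto
      then show ?thesis
        by eventually_elim (simp add: less_top)
    qed
    show "AE x in M. ?c ?P x < \<infinity>" "AE x in M. ?c ?N x < \<infinity>"
      using Y(1) by (intro *; simp add: real_integrable_def less_top)+
  qed
  \<comment> \<open>A vanishing conditional mean says that the positive and negative parts of
    \<open>Y\<close> have the same conditional expectation.\<close>
  have PN: "AE x in M. ?c ?P x = ?c ?N x"
    using Y(2) fin by eventually_elim (simp add: real_cond_exp_def, metis ennreal_enn2real)
  have le: "AE x in M. ?c (\<lambda>x. (?E x + ennreal ((u x)\<^sup>2)) + ennreal (lam x) * ?N x) x
     \<le> ?c (\<lambda>x. (1 + ennreal (lam x) * ?P x) + ennreal ((u x)\<^sup>2) * ?Z x) x"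
  proof (rule nn_cond_exp_mono)
    show "AE x in M. (?E x + ennreal ((u x)\<^sup>2)) + ennreal (lam x) * ?N x
        \<le> (1 + ennreal (lam x) * ?P x) + ennreal ((u x)\<^sup>2) * ?Z x"
    proof (rule AE_I2)
      fix x assume x: "x \<in> space M"
      have "u x * (Y x / e) = lam x * Y x" "\<bar>Y x / e\<bar> = \<bar>Y x\<bar> / e"
        using e(1) by (auto simp: u_def)
      then have "exp (lam x * Y x) \<le> 1 + lam x * Y x + ((u x)\<^sup>2 * exp (\<bar>Y x\<bar> / e) - (u x)\<^sup>2)"
        using exp_le_quadratic_scaling[OF u01[OF x], of "Y x / e"]
        by (simp only: right_diff_distrib mult_1_right)
      moreover have "lam x * Y x = lam x * max 0 (Y x) - lam x * max 0 (- Y x)"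
        by (auto simp: max_def)
      ultimately have "exp (lam x * Y x) + (u x)\<^sup>2 + lam x * max 0 (- Y x)
          \<le> 1 + lam x * max 0 (Y x) + (u x)\<^sup>2 * exp (\<bar>Y x\<bar> / e)"
        by linarith
      then have "ennreal (exp (lam x * Y x) + (u x)\<^sup>2 + lam x * max 0 (- Y x))
          \<le> ennreal (1 + lam x * max 0 (Y x) + (u x)\<^sup>2 * exp (\<bar>Y x\<bar> / e))"
        by (rule ennreal_leI)
      moreover have "ennreal (max 0 y) = ennreal y" for y
        by (auto simp: max_def ennreal_neg)
      ultimately show "(?E x + ennreal ((u x)\<^sup>2)) + ennreal (lam x) * ?N x
          \<le> (1 + ennreal (lam x) * ?P x) + ennreal ((u x)\<^sup>2) * ?Z x"
        using lam_nonneg[OF x] by (simp add: ennreal_mult)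
    qed
  qed auto
  have L: "AE x in M. ?c (\<lambda>x. (?E x + ennreal ((u x)\<^sup>2)) + ennreal (lam x) * ?N x) x
      = ?c ?E x + ennreal ((u x)\<^sup>2) + ennreal (lam x) * ?c ?N x"
  proof -
    have "AE x in M. ?c (\<lambda>x. ?E x + ennreal ((u x)\<^sup>2)) x + ?c (\<lambda>x. ennreal (lam x) * ?N x) x
        = ?c (\<lambda>x. (?E x + ennreal ((u x)\<^sup>2)) + ennreal (lam x) * ?N x) x"
      by (rule nn_cond_exp_sum) auto
    moreover have "AE x in M. ?c ?E x + ?c (\<lambda>x. ennreal ((u x)\<^sup>2)) x = ?c (\<lambda>x. ?E x + ennreal ((u x)\<^sup>2)) x"
      by (rule nn_cond_exp_sum) auto
    moreover have "AE x in M. ennreal ((u x)\<^sup>2) = ?c (\<lambda>x. ennreal ((u x)\<^sup>2)) x"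
      by (rule nn_cond_exp_F_meas) auto
    moreover have "AE x in M. ennreal (lam x) * ?c ?N x = ?c (\<lambda>x. ennreal (lam x) * ?N x) x"
      by (rule nn_cond_exp_prod) auto
    ultimately show ?thesis
      by eventually_elim metis
  qed
  have R: "AE x in M. ?c (\<lambda>x. (1 + ennreal (lam x) * ?P x) + ennreal ((u x)\<^sup>2) * ?Z x) x
      = 1 + ennreal (lam x) * ?c ?P x + ennreal ((u x)\<^sup>2) * ?c ?Z x"
  proof -
    have "AE x in M. ?c (\<lambda>x. 1 + ennreal (lam x) * ?P x) x + ?c (\<lambda>x. ennreal ((u x)\<^sup>2) * ?Z x) x
        = ?c (\<lambda>x. (1 + ennreal (lam x) * ?P x) + ennreal ((u x)\<^sup>2) * ?Z x) x"
      by (rule nn_cond_exp_sum) auto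
    moreover have "AE x in M. ?c (\<lambda>x. 1) x + ?c (\<lambda>x. ennreal (lam x) * ?P x) x = ?c (\<lambda>x. 1 + ennreal (lam x) * ?P x) x"
      by (rule nn_cond_exp_sum) auto
    moreover have "AE x in M. 1 = ?c (\<lambda>x. 1) x"
      by (rule nn_cond_exp_F_meas) auto
    moreover have "AE x in M. ennreal (lam x) * ?c ?P x = ?c (\<lambda>x. ennreal (lam x) * ?P x) x"
      by (rule nn_cond_exp_prod) auto
    moreover have "AE x in M. ennreal ((u x)\<^sup>2) * ?c ?Z x = ?c (\<lambda>x. ennreal ((u x)\<^sup>2) * ?Z x) x"
      by (rule nn_cond_exp_prod) auto
    ultimately show ?thesis
      by eventually_elim metis
  qed
  \<comment> \<open>The terms from the two parts of \<open>Y\<close> cancel, and the moment bound 2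
    less the \<open>(u x)\<^sup>2\<close> on the left leaves
    \<open>1 + (u x)\<^sup>2\<close>.\<close>
  have "AE x in M. ?c ?E x \<le> ennreal (1 + (u x)\<^sup>2)"
    using le L R fin PN e(2)
  proof eventually_elim
    case (elim x)
    then have "?c ?E x + ennreal ((u x)\<^sup>2) + ennreal (lam x) * ?c ?P x
        \<le> 1 + ennreal (lam x) * ?c ?P x + ennreal ((u x)\<^sup>2) * ?c ?Z x"
      by simp
    also have "\<dots> \<le> 1 + ennreal (lam x) * ?c ?P x + ennreal ((u x)\<^sup>2) * 2"
      using elim by (intro add_left_mono mult_left_mono) auto
    finally have "(ennreal ((u x)\<^sup>2) + ennreal (lam x) * ?c ?P x) + ?c ?E x
        \<le> (ennreal ((u x)\<^sup>2) + ennreal (lam x) * ?c ?P x) + (1 + ennreal ((u x)\<^sup>2))"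
      by (simp add: algebra_simps mult_2)
    moreover have "ennreal ((u x)\<^sup>2) + ennreal (lam x) * ?c ?P x \<noteq> \<infinity>"
      using elim by (auto simp: ennreal_mult_eq_top_iff)
    ultimately show ?case
      by (simp add: ennreal_add_left_cancel_le)
  qed
  then have E: "AE x in M. ?c ?E x \<le> ennreal (exp ((u x)\<^sup>2))"
    by eventually_elim (meson exp_ge_add_one_self ennreal_leI order_trans)
  have "(\<integral>\<^sup>+x. H x * ennreal (exp (lam x * Y x - (lam x)\<^sup>2 * e\<^sup>2)) \<partial>M)
      = (\<integral>\<^sup>+x. (H x * ennreal (exp (- (u x)\<^sup>2))) * ?E x \<partial>M)"
  proof (rule nn_integral_cong)
    fix x
    have "exp (lam x * Y x - (lam x)\<^sup>2 * e\<^sup>2) = exp (- (u x)\<^sup>2) * exp (lam x * Y x)"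
      by (simp add: u_def power_mult_distrib flip: exp_add)
    then show "H x * ennreal (exp (lam x * Y x - (lam x)\<^sup>2 * e\<^sup>2))
        = (H x * ennreal (exp (- (u x)\<^sup>2))) * ?E x"
      by (simp add: ennreal_mult mult.assoc)
  qed
  \<comment> \<open>The bracketed factor is \<open>F\<close>-measurable, so \<open>?E\<close> may be
    replaced by its conditional expectation under the integral.\<close>
  also have "\<dots> = (\<integral>\<^sup>+x. (H x * ennreal (exp (- (u x)\<^sup>2))) * ?c ?E x \<partial>M)"
    by (rule nn_cond_exp_intg[symmetric]) auto
  also have "\<dots> \<le> (\<integral>\<^sup>+x. H x \<partial>M)"
  proof (rule nn_integral_mono_AE)
    show "AE x in M. (H x * ennreal (exp (- (u x)\<^sup>2))) * ?c ?E x \<le> H x"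
      using E
    proof eventually_elim
      case (elim x)
      have "(H x * ennreal (exp (- (u x)\<^sup>2))) * ?c ?E x
          \<le> H x * (ennreal (exp (- (u x)\<^sup>2)) * ennreal (exp ((u x)\<^sup>2)))"
        using elim by (simp add: mult.assoc mult_left_mono)
      also have "\<dots> = H x"
        by (simp flip: ennreal_mult exp_add)
      finally show ?case .
    qed
  qed
  finally show ?thesis .
qed

section \<open>Ville's inequality and mixtures of supermartingales\<close>

text \<open>Stop at the first passage above \<open>c\<close>: mass that has crossed is worth at
  least \<open>c\<close>, and the rest continues as a supermartingale. The supermartingale property
  is stated through integrals over events of \<open>F t\<close>, the form in which it passes to
  mixtures.\<close>

lemma (in prob_space) ville_inequality:
  fixes W :: "nat \<Rightarrow> 'a \<Rightarrow> ennreal"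
  assumes sub: "\<And>t. subalgebra M (F t)" and mono: "\<And>t. sets (F t) \<subseteq> sets (F (Suc t))"
    and W [measurable]: "\<And>t. W t \<in> borel_measurable (F t)"
    and super: "\<And>t A. A \<in> sets (F t) \<Longrightarrow> (\<integral>\<^sup>+x\<in>A. W (Suc t) x \<partial>M) \<le> (\<integral>\<^sup>+x\<in>A. W t x \<partial>M)"
  shows "c * emeasure M {x \<in> space M. \<exists>t. c \<le> W t x} \<le> (\<integral>\<^sup>+x. W 0 x \<partial>M)"
proof -
  have space_F: "space (F t) = space M" for t
    using sub by (simp add: subalgebra_def)
  have F_M: "A \<in> sets M" if "A \<in> sets (F t)" for A t
    using sub that by (auto simp: subalgebra_def)
  have [measurable]: "W t \<in> borel_measurable M" for t
    by (rule measurable_from_subalg[OF sub W])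
  have mono': "sets (F s) \<subseteq> sets (F t)" if "s \<le> t" for s t
    using lift_Suc_mono_le[of "\<lambda>t. sets (F t)" s t] mono that by blast
  define A where "A t = {x \<in> space M. \<forall>s\<le>t. W s x < c}" for t
  have A_F: "A t \<in> sets (F t)" for t
  proof -
    have "{x \<in> space M. W s x < c} \<in> sets (F t)" if "s \<le> t" for s
    proof -
      have "{x \<in> space (F s). W s x < c} \<in> sets (F s)" by measurable
      then show ?thesis using mono'[OF that] space_F by auto
    qed
    then have "(\<Inter>s\<in>{..t}. {x \<in> space M. W s x < c}) \<in> sets (F t)"
      by (intro sets.finite_INT) auto
    also have "(\<Inter>s\<in>{..t}. {x \<in> space M. W s x < c}) = A t"
      by (auto simp: A_def)
    finally show ?thesis .
  qed
  have [measurable]: "A t \<in> sets M" for t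
    using A_F F_M by blast
  \<comment> \<open>The expectation of the stopped process, with the value at the crossing replaced
    by its lower bound \<open>c\<close>; \<open>A t\<close> is the event of no crossing up to
    \<open>t\<close>.\<close>
  have main: "c * emeasure M (space M - A t) + (\<integral>\<^sup>+x\<in>A t. W t x \<partial>M) \<le> (\<integral>\<^sup>+x. W 0 x \<partial>M)" for t
  proof (induction t)
    case 0
    have "c * emeasure M (space M - A 0) + (\<integral>\<^sup>+x\<in>A 0. W 0 x \<partial>M)
        = (\<integral>\<^sup>+x. c * indicator (space M - A 0) x + W 0 x * indicator (A 0) x \<partial>M)"
      by (simp add: nn_integral_add nn_integral_cmult_indicator)
    also have "\<dots> \<le> (\<integral>\<^sup>+x. W 0 x \<partial>M)"
      by (rule nn_integral_mono) (auto simp: A_def split: split_indicator)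
    finally show ?case .
  next
    case (Suc t)
    \<comment> \<open>The event that the first crossing happens at \<open>Suc t\<close>, where
      \<open>W (Suc t)\<close> is at least \<open>c\<close>.\<close>
    let ?D = "A t - A (Suc t)"
    have "space M - A (Suc t) = (space M - A t) \<union> ?D"
      by (auto simp: A_def)
    then have "emeasure M (space M - A (Suc t)) = emeasure M (space M - A t) + emeasure M ?D"
      by (simp add: plus_emeasure[symmetric] Int_Diff disjnt_def)
         (subst plus_emeasure, auto)
    then have "c * emeasure M (space M - A (Suc t)) + (\<integral>\<^sup>+x\<in>A (Suc t). W (Suc t) x \<partial>M)
        = c * emeasure M (space M - A t) + (\<integral>\<^sup>+x. c * indicator ?D x + W (Suc t) x * indicator (A (Suc t)) x \<partial>M)"
      by (simp add: nn_integral_add nn_integral_cmult_indicator distrib_left add.assoc)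
    also have "\<dots> \<le> c * emeasure M (space M - A t) + (\<integral>\<^sup>+x\<in>A t. W (Suc t) x \<partial>M)"
    proof (intro add_left_mono nn_integral_mono)
      fix x
      show "c * indicator ?D x + W (Suc t) x * indicator (A (Suc t)) x \<le> W (Suc t) x * indicator (A t) x"
        by (auto simp: A_def le_Suc_eq split: split_indicator)
    qed
    \<comment> \<open>Not having crossed by time \<open>t\<close> is an event of \<open>F t\<close>,
      so the supermartingale property applies on it.\<close>
    also have "\<dots> \<le> c * emeasure M (space M - A t) + (\<integral>\<^sup>+x\<in>A t. W t x \<partial>M)"
      by (intro add_left_mono super A_F)
    also note Suc
    finally show ?case .
  qed
  \<comment> \<open>Continuity from below passes from finite horizons to all times.\<close>
  have "{x \<in> space M. \<exists>t. c \<le> W t x} = (\<Union>t. space M - A t)"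
    by (auto simp: A_def not_less[symmetric])
  moreover have "incseq (\<lambda>t. space M - A t)"
    by (rule incseq_SucI) (auto simp: A_def)
  ultimately have "emeasure M {x \<in> space M. \<exists>t. c \<le> W t x} = (SUP t. emeasure M (space M - A t))"
    by (subst SUP_emeasure_incseq) auto
  then have "c * emeasure M {x \<in> space M. \<exists>t. c \<le> W t x} = (SUP t. c * emeasure M (space M - A t))"
    by (simp add: SUP_mult_left_ennreal)
  also have "\<dots> \<le> (\<integral>\<^sup>+x. W 0 x \<partial>M)"
  proof (rule SUP_least)
    show "c * emeasure M (space M - A t) \<le> (\<integral>\<^sup>+x. W 0 x \<partial>M)" for t
      using main[of t] by (meson le_add_same_cancel1 order_trans zero_le add_increasing2 order_refl)
  qed
  finally show ?thesis .
qed

text \<open>Tonelli transfers the supermartingale property from each fixed \<open>z\<close> to the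
  mixture, and Ville's inequality applies. Assumption \<open>mgf\<close> concerns only
  \<open>z\<close> with \<open>g z \<noteq> 0\<close>, so a cut-off built into \<open>g\<close>
  restricts the directions that need control.\<close>

lemma (in prob_space) exp_mixture_ville:
  fixes D :: "nat \<Rightarrow> 'a \<Rightarrow> 'b::euclidean_space" and lam v :: "nat \<Rightarrow> 'a \<Rightarrow> real" and g :: "'b \<Rightarrow> ennreal"
  assumes sub: "\<And>t. subalgebra M (F t)" and mono: "\<And>t. sets (F t) \<subseteq> sets (F (Suc t))"
    and D: "\<And>t. D (Suc t) \<in> borel_measurable (F (Suc t))"
    and lam: "\<And>t. lam (Suc t) \<in> borel_measurable (F t)"
    and v: "\<And>t. v (Suc t) \<in> borel_measurable (F t)"
    and g [measurable]: "g \<in> borel_measurable borel" and g1: "(\<integral>\<^sup>+z. g z \<partial>lborel) \<le> 1"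
    and mgf: "\<And>t z H. g z \<noteq> 0 \<Longrightarrow> H \<in> borel_measurable (F t) \<Longrightarrow>
      (\<integral>\<^sup>+x. H x * ennreal (exp (lam (Suc t) x * (z \<bullet> D (Suc t) x) - v (Suc t) x)) \<partial>M) \<le> (\<integral>\<^sup>+x. H x \<partial>M)"
  shows "c * emeasure M {x \<in> space M. \<exists>t. c \<le>
    (\<integral>\<^sup>+z. g z * ennreal (exp (z \<bullet> (\<Sum>i=1..t. lam i x *\<^sub>R D i x) - (\<Sum>i=1..t. v i x))) \<partial>lborel)} \<le> 1"
proof -
  define S where "S t x = (\<Sum>i=1..t. lam i x *\<^sub>R D i x)" for t x
  define V where "V t x = (\<Sum>i=1..t. v i x)" for t x
  define W where "W t x = (\<integral>\<^sup>+z. g z * ennreal (exp (z \<bullet> S t x - V t x)) \<partial>lborel)" for t x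
  have space_F: "space (F t) = space M" for t
    using sub by (simp add: subalgebra_def)
  have mono': "sets (F s) \<subseteq> sets (F t)" if "s \<le> t" for s t
    using lift_Suc_mono_le[of "\<lambda>t. sets (F t)" s t] mono that by blast
  have lift: "h \<in> borel_measurable (F t)" if "h \<in> borel_measurable (F s)" "s \<le> t"
    for h :: "'a \<Rightarrow> 'c::topological_space" and s t
    using measurable_from_subalg[of "F t" "F s" h borel] that mono' space_F by (simp add: subalgebra_def)
  have S [measurable]: "S t \<in> borel_measurable (F t)" for t
    unfolding S_def[abs_def]
  proof (intro borel_measurable_sum borel_measurable_scaleR)
    fix i assume "i \<in> {1..t}"
    then obtain j where "i = Suc j" "Suc j \<le> t" by (cases i) auto
    then show "lam i \<in> borel_measurable (F t)" "D i \<in> borel_measurable (F t)"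
      using lift[OF lam[of j]] lift[OF D[of j]] by auto
  qed
  have V [measurable]: "V t \<in> borel_measurable (F t)" for t
    unfolding V_def[abs_def]
  proof (intro borel_measurable_sum)
    fix i assume "i \<in> {1..t}"
    then obtain j where "i = Suc j" "Suc j \<le> t" by (cases i) auto
    then show "v i \<in> borel_measurable (F t)"
      using lift[OF v[of j]] by auto
  qed
  have [measurable]: "S t \<in> borel_measurable M" "V t \<in> borel_measurable M" for t
    using measurable_from_subalg[OF sub] S V by blast+
  interpret P: pair_sigma_finite M "lborel :: 'b measure" ..
  have "c * emeasure M {x \<in> space M. \<exists>t. c \<le> W t x} \<le> (\<integral>\<^sup>+x. W 0 x \<partial>M)"
  proof (rule ville_inequality[where F = F, OF sub mono])
    show "W t \<in> borel_measurable (F t)" for t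
      unfolding W_def[abs_def] by measurable
  next
    fix t A assume A: "A \<in> sets (F t)"
    then have [measurable]: "A \<in> sets M"
      using sub by (auto simp: subalgebra_def)
    have fubini: "(\<integral>\<^sup>+x\<in>A. W s x \<partial>M)
        = (\<integral>\<^sup>+z. (\<integral>\<^sup>+x. g z * ennreal (exp (z \<bullet> S s x - V s x)) * indicator A x \<partial>M) \<partial>lborel)" for s
    proof -
      have "(\<integral>\<^sup>+x\<in>A. W s x \<partial>M)
          = (\<integral>\<^sup>+x. (\<integral>\<^sup>+z. g z * ennreal (exp (z \<bullet> S s x - V s x)) * indicator A x \<partial>lborel) \<partial>M)"
        unfolding W_def by (intro nn_integral_cong nn_integral_multc[symmetric]) measurable
      also have "\<dots> = (\<integral>\<^sup>+z. (\<integral>\<^sup>+x. g z * ennreal (exp (z \<bullet> S s x - V s x)) * indicator A x \<partial>M) \<partial>lborel)"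
        by (rule P.Fubini'[symmetric]) measurable
      finally show ?thesis .
    qed
    show "(\<integral>\<^sup>+x\<in>A. W (Suc t) x \<partial>M) \<le> (\<integral>\<^sup>+x\<in>A. W t x \<partial>M)"
      unfolding fubini
    proof (rule nn_integral_mono)
      fix z
      show "(\<integral>\<^sup>+x. g z * ennreal (exp (z \<bullet> S (Suc t) x - V (Suc t) x)) * indicator A x \<partial>M)
          \<le> (\<integral>\<^sup>+x. g z * ennreal (exp (z \<bullet> S t x - V t x)) * indicator A x \<partial>M)"
      proof (cases "g z = 0")
        case False
        \<comment> \<open>One-step factorisation: the bracket is \<open>F t\<close>-measurable and
          serves as the test function \<open>H\<close> in \<open>mgf\<close>.\<close>
        have "g z * ennreal (exp (z \<bullet> S (Suc t) x - V (Suc t) x)) * indicator A x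
            = (g z * ennreal (exp (z \<bullet> S t x - V t x)) * indicator A x)
              * ennreal (exp (lam (Suc t) x * (z \<bullet> D (Suc t) x) - v (Suc t) x))" for x
        proof -
          have "exp (z \<bullet> S (Suc t) x - V (Suc t) x)
              = exp (z \<bullet> S t x - V t x) * exp (lam (Suc t) x * (z \<bullet> D (Suc t) x) - v (Suc t) x)"
            by (simp add: S_def V_def inner_add_right flip: exp_add)
          then show ?thesis
            by (simp add: ennreal_mult mult_ac)
        qed
        then show ?thesis
          using mgf[OF False, of "\<lambda>x. g z * ennreal (exp (z \<bullet> S t x - V t x)) * indicator A x" t] A
          by simp
      qed simp
    qed
  qed
  also have "(\<integral>\<^sup>+x. W 0 x \<partial>M) = (\<integral>\<^sup>+z. g z \<partial>lborel)"
    by (simp add: W_def S_def V_def emeasure_space_1)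
  also note g1
  finally show ?thesis
    by (simp only: W_def S_def V_def)
qed

section \<open>Conditional means of linear forms, and vanishing variables\<close>

text \<open>Linearity of the conditional expectation, with one null set for the finitely many
  coordinates.\<close>

lemma (in sigma_finite_subalgebra) real_cond_exp_inner:
  fixes X :: "'a \<Rightarrow> real^'n"
  assumes "integrable M X"
  shows "AE x in M. real_cond_exp M F (\<lambda>x. w \<bullet> X x) x = w \<bullet> vec_cond_exp M F X x"
proof -
  have X: "integrable M (\<lambda>x. X x $ k)" for k
    by (rule integrable_bounded_linear[OF bounded_linear_vec_nth assms])
  have "AE x in M. \<forall>k. real_cond_exp M F (\<lambda>x. w $ k * X x $ k) x = w $ k * real_cond_exp M F (\<lambda>x. X x $ k) x"
    unfolding AE_all_countable by (intro allI real_cond_exp_cmult X)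
  moreover have "AE x in M. real_cond_exp M F (\<lambda>x. \<Sum>k\<in>UNIV. w $ k * X x $ k) x
      = (\<Sum>k\<in>UNIV. real_cond_exp M F (\<lambda>x. w $ k * X x $ k) x)"
    by (rule real_cond_exp_sum) (simp add: X)
  ultimately show ?thesis
    by eventually_elim (simp add: inner_vec_def vec_cond_exp_def)
qed

text \<open>Integrating \<open>\<bar>Y x\<bar> \<le> e * exp (\<bar>Y x\<bar> / e)\<close> bounds
  the first absolute moment by \<open>2 * e\<close> times the total mass; let \<open>e\<close> tend
  to zero.\<close>

lemma (in finite_measure_subalgebra) AE_eq_0_if_cond_exp_exp_le:
  fixes Y :: "'a \<Rightarrow> real"
  assumes [measurable]: "Y \<in> borel_measurable M"
    and le: "\<And>e. 0 < e \<Longrightarrow> AE x in M. nn_cond_exp M F (\<lambda>x. ennreal (exp (\<bar>Y x\<bar> / e))) x \<le> 2"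
  shows "AE x in M. Y x = 0"
proof -
  let ?m = "measure M (space M)"
  have *: "(\<integral>\<^sup>+x. ennreal \<bar>Y x\<bar> \<partial>M) \<le> ennreal (e * (2 * ?m))" if "0 < e" for e
  proof -
    have "(\<integral>\<^sup>+x. ennreal \<bar>Y x\<bar> \<partial>M) \<le> (\<integral>\<^sup>+x. ennreal e * ennreal (exp (\<bar>Y x\<bar> / e)) \<partial>M)"
    proof (rule nn_integral_mono)
      fix x
      have "\<bar>Y x\<bar> / e \<le> exp (\<bar>Y x\<bar> / e)"
        using exp_ge_add_one_self[of "\<bar>Y x\<bar> / e"] by linarith
      then show "ennreal \<bar>Y x\<bar> \<le> ennreal e * ennreal (exp (\<bar>Y x\<bar> / e))"
        using that by (auto simp: field_simps intro!: ennreal_leI simp flip: ennreal_mult)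
    qed
    also have "\<dots> = ennreal e * (\<integral>\<^sup>+x. 1 * ennreal (exp (\<bar>Y x\<bar> / e)) \<partial>M)"
      by (simp add: nn_integral_cmult)
    also have "\<dots> = ennreal e * (\<integral>\<^sup>+x. 1 * nn_cond_exp M F (\<lambda>x. ennreal (exp (\<bar>Y x\<bar> / e))) x \<partial>M)"
      by (subst nn_cond_exp_intg) auto
    also have "\<dots> \<le> ennreal e * (\<integral>\<^sup>+x. 2 \<partial>M)"
      using le[OF that] by (intro mult_left_mono nn_integral_mono_AE) auto
    also have "\<dots> = ennreal (e * (2 * ?m))"
      using that by (simp add: emeasure_eq_measure ennreal_mult)
    finally show ?thesis .
  qed
  have "(\<integral>\<^sup>+x. ennreal \<bar>Y x\<bar> \<partial>M) \<le> 0"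
  proof (rule ennreal_le_epsilon)
    fix d :: real
    assume "0 < d"
    \<comment> \<open>The added 1 keeps the divisor positive even for the null measure.\<close>
    have "(\<integral>\<^sup>+x. ennreal \<bar>Y x\<bar> \<partial>M) \<le> ennreal (d / (2 * ?m + 1) * (2 * ?m))"
      using * [of "d / (2 * ?m + 1)"] \<open>0 < d\<close> by (simp add: add_nonneg_pos)
    also have "\<dots> \<le> ennreal d"
      using \<open>0 < d\<close> by (intro ennreal_leI) (simp add: divide_le_eq add_nonneg_pos distrib_left)
    finally show "(\<integral>\<^sup>+x. ennreal \<bar>Y x\<bar> \<partial>M) \<le> 0 + ennreal d" by simp
  qed
  then have "AE x in M. ennreal \<bar>Y x\<bar> = 0"
    by (subst (asm) le_zero_eq, subst (asm) nn_integral_0_iff_AE) auto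
  then show ?thesis
    by eventually_elim (simp add: ennreal_eq_0_iff)
qed

section \<open>Sub-exponential vectors\<close>

lemma space_nat_filtration [simp]: "space (nat_filtration M X t) = space M"
  by (simp add: nat_filtration_def space_measure_of_conv)

lemma sets_nat_filtration:
  "sets (nat_filtration M X t) = sigma_sets (space M) (\<Union>i\<in>{1..t}. {X i -` A \<inter> space M |A. A \<in> sets borel})"
  unfolding nat_filtration_def by (rule sets_measure_of) auto

lemma sets_nat_filtration_mono: "s \<le> t \<Longrightarrow> sets (nat_filtration M X s) \<subseteq> sets (nat_filtration M X t)"
  unfolding sets_nat_filtration by (intro sigma_sets_mono' UN_mono) auto

lemma measurable_nat_filtration: "1 \<le> i \<Longrightarrow> i \<le> t \<Longrightarrow> X i \<in> borel_measurable (nat_filtration M X t)"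
  by (rule measurableI) (simp_all add: sets_nat_filtration, fastforce intro!: sigma_sets.Basic)

lemma onorm_quadratic_form_le: "x \<bullet> (A *v x) \<le> onorm ((*v) A) * (norm x)\<^sup>2" for A :: "real^'n^'n"
proof -
  have "x \<bullet> (A *v x) \<le> norm x * norm (A *v x)"
    by (rule norm_cauchy_schwarz)
  also have "\<dots> \<le> norm x * (onorm ((*v) A) * norm x)"
    by (intro mult_left_mono onorm matrix_vector_mul_bounded_linear) auto
  finally show ?thesis
    by (simp add: power2_eq_square mult_ac)
qed

text \<open>Identifies the sum over \<open>Basis\<close> produced by the Gaussian second moments
  with the matrix trace in \<open>h_fun\<close>.\<close>

lemma trace_eq_sum_Basis: "trace A = (\<Sum>b\<in>Basis. b \<bullet> (A *v b))" for A :: "real^'n^'n"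
proof -
  have "(\<Sum>b\<in>Basis. b \<bullet> (A *v b)) = (\<Sum>b\<in>range (\<lambda>i::'n. axis i 1). b \<bullet> (A *v b))"
    by (rule sum.cong) (auto simp: Basis_vec_def)
  also have "\<dots> = (\<Sum>i\<in>UNIV. axis i 1 \<bullet> (A *v axis i 1))"
    by (subst sum.reindex) (auto simp: inj_on_def axis_eq_axis)
  also have "\<dots> = trace A"
    by (simp add: trace_def inner_axis' matrix_vector_mult_basis column_def)
  finally show ?thesis by simp
qed

lemma psd_trace_nonneg: "psd_matrix A \<Longrightarrow> 0 \<le> trace A" for A :: "real^'n^'n"
  by (simp add: trace_eq_sum_Basis psd_matrix_def sum_nonneg)

lemma onorm_matrix_nonneg: "0 \<le> onorm ((*v) A)" for A :: "real^'n^'n"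
  by (rule onorm_pos_le[OF matrix_vector_mul_bounded_linear])

lemma h_fun_nonneg: "psd_matrix A \<Longrightarrow> 0 \<le> u \<Longrightarrow> 0 \<le> h_fun A u"
  by (simp add: h_fun_def psd_trace_nonneg onorm_matrix_nonneg)

section \<open>Exponential moments and deviations of a sub-exponential process\<close>

locale subexponential_process = prob_space M for M :: "'a measure" +
  fixes X :: "nat \<Rightarrow> 'a \<Rightarrow> real^'n" and \<mu> :: "real^'n" and \<Sigma> :: "real^'n^'n" and C :: real
  assumes C: "0 < C" and psd: "psd_matrix \<Sigma>"
    and X_borel: "\<And>t. 1 \<le> t \<Longrightarrow> X t \<in> borel_measurable M"
    and X_int: "\<And>t. 1 \<le> t \<Longrightarrow> integrable M (X t)"
    and mean: "\<And>t. 1 \<le> t \<Longrightarrow> AE \<omega> in M. vec_cond_exp M (nat_filtration M X (t - 1)) (X t) \<omega> = \<mu>"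
    and orlicz: "\<And>t \<theta>. 1 \<le> t \<Longrightarrow> AE \<omega> in M. cond_orlicz1 M (nat_filtration M X (t - 1))
      (\<lambda>x. \<theta> \<bullet> (X t x - vec_cond_exp M (nat_filtration M X (t - 1)) (X t) x)) \<omega>
      \<le> ennreal (C * sqrt (\<theta> \<bullet> (\<Sigma> *v \<theta>)))"
begin

lemma sub: "subalgebra M (nat_filtration M X t)"
  by (rule subalgebra_nat_filtration[OF X_borel])

lemma finite_sub: "finite_measure_subalgebra M (nat_filtration M X t)"
  by unfold_locales (rule sub)

lemma psd_nonneg: "0 \<le> \<theta> \<bullet> (\<Sigma> *v \<theta>)"
  using psd by (simp add: psd_matrix_def)

text \<open>Turns the Orlicz bound into an exponential moment, for \<open>e\<close> strictly above
  the bound as in \<open>AE_cond_orlicz1_le_iff\<close>, and replaces the conditional mean by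
  \<open>\<mu>\<close> almost surely.\<close>

lemma cond_exp_exp_le:
  assumes t: "1 \<le> t" and e: "C * sqrt (\<theta> \<bullet> (\<Sigma> *v \<theta>)) < e"
  shows "AE \<omega> in M. nn_cond_exp M (nat_filtration M X (t - 1)) (\<lambda>x. ennreal (exp (\<bar>\<theta> \<bullet> (X t x - \<mu>)\<bar> / e))) \<omega> \<le> 2"
proof -
  let ?F = "nat_filtration M X (t - 1)"
  interpret G: finite_measure_subalgebra M ?F by (rule finite_sub)
  have [measurable]: "X t \<in> borel_measurable M"
    by (rule X_borel[OF t])
  have "(\<lambda>x. vec_cond_exp M ?F (X t) x $ k) \<in> borel_measurable M" for k
    by (simp add: vec_cond_exp_def borel_measurable_cond_exp2)
  then have [measurable]: "vec_cond_exp M ?F (X t) \<in> borel_measurable M"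
    by (subst borel_measurable_euclidean_space) (auto simp: Basis_vec_def inner_axis)
  have "AE \<omega> in M. nn_cond_exp M ?F (\<lambda>x. ennreal (exp (\<bar>\<theta> \<bullet> (X t x - vec_cond_exp M ?F (X t) x)\<bar> / e))) \<omega> \<le> 2"
  proof (rule AE_cond_orlicz1_le_iff[THEN iffD1, OF G.sigma_finite_subalgebra_axioms _ _ orlicz[OF t], rule_format, OF _ _ e])
    show "0 \<le> C * sqrt (\<theta> \<bullet> (\<Sigma> *v \<theta>))"
      using C by (simp add: psd_nonneg)
  qed measurable
  moreover have "AE \<omega> in M.
      nn_cond_exp M ?F (\<lambda>x. ennreal (exp (\<bar>\<theta> \<bullet> (X t x - vec_cond_exp M ?F (X t) x)\<bar> / e))) \<omega>
      = nn_cond_exp M ?F (\<lambda>x. ennreal (exp (\<bar>\<theta> \<bullet> (X t x - \<mu>)\<bar> / e))) \<omega>"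
  proof (rule G.nn_cond_exp_cong)
    show "AE \<omega> in M. ennreal (exp (\<bar>\<theta> \<bullet> (X t \<omega> - vec_cond_exp M ?F (X t) \<omega>)\<bar> / e))
        = ennreal (exp (\<bar>\<theta> \<bullet> (X t \<omega> - \<mu>)\<bar> / e))"
      using mean[OF t] by eventually_elim simp
  qed measurable
  ultimately show ?thesis
    by eventually_elim simp
qed

lemma real_cond_exp_centered:
  assumes t: "1 \<le> t"
  shows "AE \<omega> in M. real_cond_exp M (nat_filtration M X (t - 1)) (\<lambda>x. \<theta> \<bullet> (X t x - \<mu>)) \<omega> = 0"
proof -
  let ?F = "nat_filtration M X (t - 1)"
  interpret G: finite_measure_subalgebra M ?F by (rule finite_sub)
  have "AE \<omega> in M. real_cond_exp M ?F (\<lambda>x. \<theta> \<bullet> X t x - \<theta> \<bullet> \<mu>) \<omega>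
      = real_cond_exp M ?F (\<lambda>x. \<theta> \<bullet> X t x) \<omega> - real_cond_exp M ?F (\<lambda>x. \<theta> \<bullet> \<mu>) \<omega>"
    by (rule G.real_cond_exp_diff) (auto intro: X_int t)
  moreover have "AE \<omega> in M. real_cond_exp M ?F (\<lambda>x. \<theta> \<bullet> \<mu>) \<omega> = \<theta> \<bullet> \<mu>"
    by (rule G.real_cond_exp_F_meas) auto
  ultimately show ?thesis
    using G.real_cond_exp_inner[OF X_int[OF t], of \<theta>] mean[OF t]
    by eventually_elim (simp add: inner_diff_right)
qed

text \<open>One step of the exponential supermartingale in direction \<open>\<theta>\<close>.
  Weights below one and \<open>e \<le> 1\<close> give the condition \<open>lam * e \<le> 1\<close>
  of \<open>nn_integral_exp_compensated_le\<close>; the strict lower bound on \<open>e\<close> makes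
  it positive.\<close>

lemma nn_integral_exp_le:
  assumes t: "1 \<le> t" and e: "C * sqrt (\<theta> \<bullet> (\<Sigma> *v \<theta>)) < e" "e \<le> 1"
    and lam: "lam \<in> borel_measurable (nat_filtration M X (t - 1))" "\<And>\<omega>. \<omega> \<in> space M \<Longrightarrow> lam \<omega> \<in> {0<..<1}"
    and H: "H \<in> borel_measurable (nat_filtration M X (t - 1))"
  shows "(\<integral>\<^sup>+\<omega>. H \<omega> * ennreal (exp (lam \<omega> * (\<theta> \<bullet> (X t \<omega> - \<mu>)) - (lam \<omega>)\<^sup>2 * e\<^sup>2)) \<partial>M) \<le> (\<integral>\<^sup>+\<omega>. H \<omega> \<partial>M)"
proof -
  interpret G: finite_measure_subalgebra M "nat_filtration M X (t - 1)" by (rule finite_sub)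
  have "0 \<le> C * sqrt (\<theta> \<bullet> (\<Sigma> *v \<theta>))"
    using C by (simp add: psd_nonneg)
  then have "0 < e"
    using e by linarith
  show ?thesis
  proof (rule G.nn_integral_exp_compensated_le)
    show "integrable M (\<lambda>\<omega>. \<theta> \<bullet> (X t \<omega> - \<mu>))"
      using X_int[OF t] by auto
    show "lam \<omega> * e \<le> 1" if "\<omega> \<in> space M" for \<omega>
      using lam(2)[OF that] \<open>0 < e\<close> e(2) mult_mono[of "lam \<omega>" 1 e 1] by auto
    show "0 \<le> lam \<omega>" if "\<omega> \<in> space M" for \<omega>
      using lam(2)[OF that] by simp
  qed (fact real_cond_exp_centered[OF t] cond_exp_exp_le[OF t e(1)] lam(1) H \<open>0 < e\<close>)+
qed

text \<open>All Orlicz bounds are zero here, so every coordinate of the deviation vanishes almost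
  surely. This settles the case in which the normalising factor \<open>a + b\<close> of the Gaussian
  argument would be zero.\<close>

lemma AE_eq_mean_if_degenerate:
  assumes "onorm ((*v) \<Sigma>) = 0" and t: "1 \<le> t"
  shows "AE \<omega> in M. X t \<omega> = \<mu>"
proof -
  interpret G: finite_measure_subalgebra M "nat_filtration M X (t - 1)" by (rule finite_sub)
  have [measurable]: "X t \<in> borel_measurable M"
    by (rule X_borel[OF t])
  have "\<theta> \<bullet> (\<Sigma> *v \<theta>) = 0" for \<theta>
    using onorm_quadratic_form_le[of \<theta> \<Sigma>] psd_nonneg[of \<theta>] assms(1) by simp
  then have "AE \<omega> in M. \<theta> \<bullet> (X t \<omega> - \<mu>) = 0" for \<theta>
    using cond_exp_exp_le[OF t, of \<theta>] by (intro G.AE_eq_0_if_cond_exp_exp_le) auto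
  then have "AE \<omega> in M. \<forall>k. axis k 1 \<bullet> (X t \<omega> - \<mu>) = 0"
    by (simp add: AE_all_countable)
  then show ?thesis
    by eventually_elim (simp add: vec_eq_iff inner_axis')
qed

text \<open>The numbers \<open>a\<close>, \<open>b\<close> satisfy \<open>h_fun \<Sigma> L = (a + b) * L\<close>. The prior is the centred Gaussian of
  variance \<open>s\<^sup>2 = \<gamma>\<^sup>2 / (2 L)\<close> cut off at \<open>2 C\<^sup>2 (x \<bullet> \<Sigma> x) \<le> 1\<close>; shifting it by \<open>\<gamma>\<close> times the direction of
  the deviation costs exactly \<open>L\<close> in the exponent.\<close>

lemma time_uniform_deviation:
  fixes lam :: "nat \<Rightarrow> 'a \<Rightarrow> real" and L :: real
  assumes lam: "\<And>t. 1 \<le> t \<Longrightarrow> lam t \<in> borel_measurable (nat_filtration M X (t - 1))"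
    and lam01: "\<And>t \<omega>. 1 \<le> t \<Longrightarrow> \<omega> \<in> space M \<Longrightarrow> lam t \<omega> \<in> {0<..<1}"
    and "0 < L" and ab: "a = sqrt (onorm ((*v) \<Sigma>))" "b = sqrt (trace \<Sigma> / L)" "0 < a"
  shows "emeasure M {\<omega> \<in> space M. \<not> (\<forall>t. norm (\<Sum>i=1..t. lam i \<omega> *\<^sub>R (X i \<omega> - \<mu>))
      < 2 * C * (a + b) * (2 * L + 3/4 * (\<Sum>i=1..t. (lam i \<omega>)\<^sup>2)))} \<le> ennreal (2 * exp (- L))"
proof -
  \<comment> \<open>The largest shift for which
    \<open>2 * (a + b)\<^sup>2 * \<gamma>\<^sup>2\<close> does not exceed \<open>r\<close>.\<close>
  define \<gamma> where "\<gamma> = 1 / (2 * C * (a + b))"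
  define s where "s = \<gamma> / sqrt (2 * L)"
  define r where "r = 1 / (2 * C\<^sup>2)"
  \<comment> \<open>\<open>e\<^sup>2 = 3/4\<close> lies strictly between
    \<open>C\<^sup>2 * r = 1/2\<close> and 1, as \<open>nn_integral_exp_le\<close> requires on the
    ellipsoid; it is the factor of the sum of squared weights in the bound.\<close>
  define e where "e = sqrt (3/4 :: real)"
  define g where "g x = ennreal (gauss_density s x) * indicator {x. x \<bullet> (\<Sigma> *v x) \<le> r} x" for x :: "real^'n"
  define S where "S t \<omega> = (\<Sum>i=1..t. lam i \<omega> *\<^sub>R (X i \<omega> - \<mu>))" for t \<omega>
  define V where "V t \<omega> = (\<Sum>i=1..t. (lam i \<omega>)\<^sup>2 * e\<^sup>2)" for t \<omega>
  define W where "W t \<omega> = (\<integral>\<^sup>+x. g x * ennreal (exp (x \<bullet> S t \<omega> - V t \<omega>)) \<partial>lborel)" for t \<omega>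
  have tr: "0 \<le> trace \<Sigma>"
    by (rule psd_trace_nonneg[OF psd])
  have b: "0 \<le> b" "b\<^sup>2 = trace \<Sigma> / L"
    using tr \<open>0 < L\<close> by (simp_all add: ab)
  have a: "a\<^sup>2 = onorm ((*v) \<Sigma>)"
    by (simp add: ab onorm_matrix_nonneg)
  have \<gamma>: "0 < \<gamma>"
    using C b ab(3) by (simp add: \<gamma>_def)
  have s: "0 < s" "s\<^sup>2 = \<gamma>\<^sup>2 / (2 * L)"
    using \<gamma> \<open>0 < L\<close> by (simp_all add: s_def power_divide)
  have lin: "linear ((*v) \<Sigma>)" by simp
  have [measurable]: "(*v) \<Sigma> \<in> borel_measurable borel"
    by (intro borel_measurable_continuous_onI linear_continuous_on matrix_vector_mul_bounded_linear)
  have g [measurable]: "g \<in> borel_measurable borel"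
    unfolding g_def[abs_def] by measurable
  have lower: "ennreal (exp (\<gamma> * norm z - v - L) / 2) \<le> (\<integral>\<^sup>+x. g x * ennreal (exp (x \<bullet> z - v)) \<partial>lborel)" for z v
  proof -
    \<comment> \<open>The shift points along the deviation \<open>z\<close>; for
      \<open>z = 0\<close> it is zero, hence only an inequality for its norm.\<close>
    define w where "w = \<gamma> *\<^sub>R sgn z"
    have norm_w: "(norm w)\<^sup>2 \<le> \<gamma>\<^sup>2"
      by (simp add: w_def norm_sgn power_mult_distrib)
    have "w \<bullet> (\<Sigma> *v w) \<le> a\<^sup>2 * \<gamma>\<^sup>2"
      using onorm_quadratic_form_le[of w \<Sigma>] mult_left_mono[OF norm_w, of "a\<^sup>2"]
      unfolding a[symmetric] by simp
    \<comment> \<open>The choice of \<open>s\<close> makes the Gaussian's share of the radius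
      \<open>2 * b\<^sup>2 * \<gamma>\<^sup>2\<close>, matching the share
      \<open>2 * a\<^sup>2 * \<gamma>\<^sup>2\<close> of the shift; together they fit into
      \<open>r\<close>.\<close>
    moreover have "4 * (s\<^sup>2 * trace \<Sigma>) = 2 * b\<^sup>2 * \<gamma>\<^sup>2"
      by (simp add: s b)
    moreover have "2 * (a\<^sup>2 + b\<^sup>2) * \<gamma>\<^sup>2 \<le> 2 * (a + b)\<^sup>2 * \<gamma>\<^sup>2"
      using ab(3) b by (intro mult_right_mono) (auto simp: power2_sum)
    moreover have "2 * (a + b)\<^sup>2 * \<gamma>\<^sup>2 = r"
      using C ab(3) b by (simp add: \<gamma>_def r_def power_divide power_mult_distrib)
    ultimately have "2 * (w \<bullet> (\<Sigma> *v w)) + 4 * (s\<^sup>2 * (\<Sum>b\<in>Basis. b \<bullet> (\<Sigma> *v b))) \<le> r"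
      by (simp add: trace_eq_sum_Basis[symmetric] algebra_simps)
    then have "ennreal (exp (w \<bullet> z - v - (norm w)\<^sup>2 / (2 * s\<^sup>2)) / 2) \<le> (\<integral>\<^sup>+x. g x * ennreal (exp (x \<bullet> z - v)) \<partial>lborel)"
      unfolding g_def by (intro gauss_mixture_exp_ge s lin psd_nonneg)
    moreover have "w \<bullet> z = \<gamma> * norm z"
      by (cases "z = 0") (auto simp: w_def sgn_div_norm power2_norm_eq_inner[symmetric] power2_eq_square)
    moreover have "(norm w)\<^sup>2 / (2 * s\<^sup>2) \<le> L"
      using norm_w \<gamma> \<open>0 < L\<close> by (simp add: s divide_le_eq mult.commute)
    ultimately show ?thesis
      by (elim order_trans[rotated]) (auto intro!: ennreal_leI)
  qed
  \<comment> \<open>For \<open>L = ln (2 / \<alpha>)\<close> the threshold \<open>exp L / 2\<close>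
    is \<open>1 / \<alpha>\<close>.\<close>
  have "ennreal (exp L / 2) * emeasure M {\<omega> \<in> space M. \<exists>t. ennreal (exp L / 2) \<le> W t \<omega>} \<le> 1"
    unfolding W_def S_def V_def
  proof (rule exp_mixture_ville[where F = "nat_filtration M X"])
    show "sets (nat_filtration M X t) \<subseteq> sets (nat_filtration M X (Suc t))" for t
      by (rule sets_nat_filtration_mono) simp
    show "(\<lambda>\<omega>. X (Suc t) \<omega> - \<mu>) \<in> borel_measurable (nat_filtration M X (Suc t))" for t
      using measurable_nat_filtration[of "Suc t" "Suc t" X M] by simp
    show "lam (Suc t) \<in> borel_measurable (nat_filtration M X t)" for t
      using lam[of "Suc t"] by simp
    then show "(\<lambda>\<omega>. (lam (Suc t) \<omega>)\<^sup>2 * e\<^sup>2) \<in> borel_measurable (nat_filtration M X t)" for t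
      by measurable
    have "(\<integral>\<^sup>+x. g x \<partial>lborel) \<le> (\<integral>\<^sup>+x. ennreal (gauss_density s x) \<partial>(lborel :: (real^'n) measure))"
      unfolding g_def by (rule nn_integral_mono) (auto split: split_indicator)
    then show "(\<integral>\<^sup>+x. g x \<partial>lborel) \<le> 1"
      by (simp add: nn_integral_gauss_density s)
  next
    fix t z and H :: "'a \<Rightarrow> ennreal"
    assume z: "g z \<noteq> 0" and H: "H \<in> borel_measurable (nat_filtration M X t)"
    have "z \<bullet> (\<Sigma> *v z) \<le> r"
      using z by (auto simp: g_def split: split_indicator_asm)
    then have "C\<^sup>2 * (z \<bullet> (\<Sigma> *v z)) \<le> C\<^sup>2 * r"
      by (intro mult_left_mono) auto
    also have "\<dots> < 3/4"
      using C by (simp add: r_def)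
    finally have "sqrt (C\<^sup>2 * (z \<bullet> (\<Sigma> *v z))) < e"
      unfolding e_def by (rule real_sqrt_less_mono)
    then have "C * sqrt (z \<bullet> (\<Sigma> *v z)) < e"
      using C by (simp add: real_sqrt_mult)
    moreover have "e \<le> 1"
      by (simp add: e_def real_le_lsqrt)
    ultimately show "(\<integral>\<^sup>+\<omega>. H \<omega> * ennreal (exp (lam (Suc t) \<omega> * (z \<bullet> (X (Suc t) \<omega> - \<mu>)) - (lam (Suc t) \<omega>)\<^sup>2 * e\<^sup>2)) \<partial>M)
        \<le> (\<integral>\<^sup>+\<omega>. H \<omega> \<partial>M)"
      using lam[of "Suc t"] lam01[of "Suc t"] H by (intro nn_integral_exp_le) auto
  qed (auto intro: sub)
  then have "ennreal (2 * exp (- L)) * (ennreal (exp L / 2) * emeasure M {\<omega> \<in> space M. \<exists>t. ennreal (exp L / 2) \<le> W t \<omega>})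
      \<le> ennreal (2 * exp (- L)) * 1"
    by (rule mult_left_mono) simp
  moreover have "ennreal (2 * exp (- L)) * ennreal (exp L / 2) = 1"
    by (simp add: exp_minus flip: ennreal_mult)
  ultimately have "emeasure M {\<omega> \<in> space M. \<exists>t. ennreal (exp L / 2) \<le> W t \<omega>} \<le> ennreal (2 * exp (- L))"
    by (simp add: mult.assoc[symmetric])
  \<comment> \<open>A deviation this large gives
    \<open>\<gamma> * norm (S t \<omega>) \<ge> 2 * L + V t \<omega>\<close>: one \<open>L\<close>
    pays for the shift, the other reaches the threshold.\<close>
  moreover have "\<not> norm (S t \<omega>) < 2 * C * (a + b) * (2 * L + 3/4 * (\<Sum>i=1..t. (lam i \<omega>)\<^sup>2))
      \<Longrightarrow> ennreal (exp L / 2) \<le> W t \<omega>" for t \<omega>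
  proof -
    assume n: "\<not> norm (S t \<omega>) < 2 * C * (a + b) * (2 * L + 3/4 * (\<Sum>i=1..t. (lam i \<omega>)\<^sup>2))"
    have V: "V t \<omega> = 3/4 * (\<Sum>i=1..t. (lam i \<omega>)\<^sup>2)"
      by (simp add: V_def e_def sum_distrib_left mult.commute)
    have "\<gamma> * (2 * C * (a + b) * (2 * L + V t \<omega>)) \<le> \<gamma> * norm (S t \<omega>)"
      using n \<gamma> unfolding V[symmetric] by (intro mult_left_mono) auto
    moreover have "\<gamma> * (2 * C * (a + b) * (2 * L + V t \<omega>)) = 2 * L + V t \<omega>"
      using C ab(3) b by (simp add: \<gamma>_def)
    ultimately have "exp L / 2 \<le> exp (\<gamma> * norm (S t \<omega>) - V t \<omega> - L) / 2"
      by simp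
    then show "ennreal (exp L / 2) \<le> W t \<omega>"
      using lower[of "S t \<omega>" "V t \<omega>"] unfolding W_def by (meson ennreal_leI order_trans)
  qed
  moreover have "{\<omega> \<in> space M. \<exists>t. ennreal (exp L / 2) \<le> W t \<omega>} \<in> sets M"
  proof -
    have [measurable]: "S t \<in> borel_measurable M" "V t \<in> borel_measurable M" for t
      unfolding S_def[abs_def] V_def[abs_def]
      using measurable_from_subalg[OF sub lam] X_borel
      by (auto intro!: borel_measurable_sum borel_measurable_scaleR borel_measurable_diff borel_measurable_times
          borel_measurable_power)
    have [measurable]: "W t \<in> borel_measurable M" for t
      unfolding W_def[abs_def] by measurable
    show ?thesis by measurable
  qed
  ultimately show ?thesis
    by (elim order_trans[rotated]) (auto intro!: emeasure_mono simp: S_def)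
qed

end

section \<open>The confidence sequence for the mean\<close>

theorem theorem2p8:
  fixes M :: "'a measure"
    and X :: "nat \<Rightarrow> 'a \<Rightarrow> real^'n"
    and lam :: "nat \<Rightarrow> 'a \<Rightarrow> real"
    and \<mu> :: "real^'n"
    and \<Sigma> :: "real^'n^'n"
    and C \<alpha> :: real
  assumes "prob_space M"
    and "0 < C"
    and "psd_matrix \<Sigma>"
    and "\<And>t. 1 \<le> t \<Longrightarrow> X t \<in> borel_measurable M"
    and "\<And>t. 1 \<le> t \<Longrightarrow> integrable M (X t)"
    and "\<And>t. 1 \<le> t \<Longrightarrow> AE \<omega> in M. vec_cond_exp M (nat_filtration M X (t - 1)) (X t) \<omega> = \<mu>"
    and "\<And>t \<theta>. 1 \<le> t \<Longrightarrow> AE \<omega> in M.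
           cond_orlicz1 M (nat_filtration M X (t - 1))
             (\<lambda>x. \<theta> \<bullet> (X t x - vec_cond_exp M (nat_filtration M X (t - 1)) (X t) x)) \<omega>
           \<le> ennreal (C * sqrt (\<theta> \<bullet> (\<Sigma> *v \<theta>)))"
    and "\<And>t. 1 \<le> t \<Longrightarrow> lam t \<in> borel_measurable (nat_filtration M X (t - 1))"
    and "\<And>t \<omega>. 1 \<le> t \<Longrightarrow> \<omega> \<in> space M \<Longrightarrow> lam t \<omega> \<in> {0<..<1}"
    and "\<alpha> \<in> {0<..<1}"
  shows "measure M {\<omega> \<in> space M. \<forall>t\<ge>1.
           norm ((\<Sum>i=1..t. lam i \<omega> *\<^sub>R X i \<omega>) /\<^sub>R (\<Sum>i=1..t. lam i \<omega>) - \<mu>)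
           \<le> (2 * C * h_fun \<Sigma> 1 * (\<Sum>i=1..t. (lam i \<omega>)\<^sup>2) + 4 * C * h_fun \<Sigma> (ln (2 / \<alpha>)))
               / (\<Sum>i=1..t. lam i \<omega>)}
         \<ge> 1 - \<alpha>"
proof -
  interpret subexponential_process M X \<mu> \<Sigma> C
    by (intro subexponential_process.intro subexponential_process_axioms.intro assms)
  define S where "S t \<omega> = (\<Sum>i=1..t. lam i \<omega> *\<^sub>R (X i \<omega> - \<mu>))" for t \<omega>
  define Q where "Q t \<omega> = (\<Sum>i=1..t. (lam i \<omega>)\<^sup>2)" for t \<omega>
  define L where "L = ln (2 / \<alpha>)"
  define a where "a = sqrt (onorm ((*v) \<Sigma>))"
  define b where "b = sqrt (trace \<Sigma> / L)"
  let ?R = "\<lambda>t \<omega>. 2 * C * h_fun \<Sigma> 1 * Q t \<omega> + 4 * C * h_fun \<Sigma> L"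
  let ?A = "{\<omega> \<in> space M. \<forall>t\<ge>1. norm (S t \<omega>) \<le> ?R t \<omega>}"
  have lam_M: "lam t \<in> borel_measurable M" if "1 \<le> t" for t
    by (rule measurable_from_subalg[OF sub assms(8)[OF that]])
  have [measurable]: "S t \<in> borel_measurable M" "Q t \<in> borel_measurable M" for t
    unfolding S_def[abs_def] Q_def[abs_def] using lam_M assms(4)
    by (auto intro!: borel_measurable_sum borel_measurable_scaleR borel_measurable_diff borel_measurable_power)
  have A [measurable]: "?A \<in> sets M"
    by measurable
  have \<alpha>: "0 < \<alpha>" "\<alpha> < 1"
    using assms(10) by auto
  have "ln 2 \<le> L"
    using \<alpha> by (simp add: L_def field_simps)
  \<comment> \<open>Since \<open>2/3\<close> exceeds \<open>9/16\<close>, this yields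
    \<open>3/4 \<le> sqrt L\<close> below.\<close>
  then have L: "2/3 \<le> L" "0 < L"
    using ln2_ge_two_thirds by linarith+
  have tr: "0 \<le> trace \<Sigma>"
    by (rule psd_trace_nonneg[OF psd])
  have "1 - \<alpha> \<le> measure M ?A"
  \<comment> \<open>If \<open>a = 0\<close>, the observations equal \<open>\<mu>\<close> almost
    surely at all times and the deviation is zero; otherwise the Gaussian mixture bound
    applies.\<close>
  proof (cases "a = 0")
    case True
    then have "onorm ((*v) \<Sigma>) = 0"
      by (simp add: a_def)
    then have "AE \<omega> in M. \<forall>t\<in>{1..}. X t \<omega> = \<mu>"
      by (subst AE_ball_countable) (auto intro: AE_eq_mean_if_degenerate)
    then have "AE \<omega> in M. \<omega> \<in> ?A"
      using AE_space
    proof eventually_elim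
      case (elim \<omega>)
      have "S t \<omega> = 0" for t
        using elim(1) by (auto simp: S_def intro!: sum.neutral)
      moreover have "0 \<le> ?R t \<omega>" for t
        using C L psd h_fun_nonneg[of \<Sigma> 1] h_fun_nonneg[of \<Sigma> L]
        by (intro add_nonneg_nonneg mult_nonneg_nonneg) (auto simp: Q_def sum_nonneg)
      ultimately show ?case
        using elim(2) by simp
    qed
    then have "measure M ?A = 1"
      using prob_eq_1[OF A] by simp
    then show ?thesis
      using \<alpha> by simp
  next
    case False
    then have "0 < a"
      by (simp add: a_def onorm_matrix_nonneg order_less_le)
    \<comment> \<open>The term \<open>h_fun \<Sigma> L\<close> is matched exactly. For the other,
      \<open>b\<close> can exceed \<open>sqrt (trace \<Sigma>)\<close> when \<open>L < 1\<close>,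
      but only by the factor \<open>1 / sqrt L \<le> 4/3\<close>, which the factor
      \<open>3/4\<close> absorbs.\<close>
    have R: "2 * C * (a + b) * (2 * L + 3/4 * Q t \<omega>) \<le> ?R t \<omega>" for t \<omega>
    proof -
      have Q: "0 \<le> Q t \<omega>"
        by (simp add: Q_def sum_nonneg)
      have bL: "b * L = sqrt (trace \<Sigma> * L)"
        using L real_div_sqrt[of L] by (simp add: b_def real_sqrt_divide real_sqrt_mult flip: times_divide_eq_right)
      have "3/4 \<le> sqrt L"
        using L by (intro real_le_rsqrt) (auto simp: power2_eq_square)
      then have "3/4 * sqrt (trace \<Sigma>) \<le> sqrt L * sqrt (trace \<Sigma>)"
        using tr by (intro mult_right_mono) auto
      then have "3/4 * b \<le> sqrt (trace \<Sigma>)"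
        using L by (simp add: b_def real_sqrt_divide field_simps)
      moreover have "3/4 * a \<le> a"
        using \<open>0 < a\<close> by simp
      ultimately have "3/4 * (a + b) \<le> h_fun \<Sigma> 1"
        unfolding h_fun_def a_def[symmetric] by simp
      then have "2 * C * (3/4 * (a + b)) * Q t \<omega> \<le> 2 * C * h_fun \<Sigma> 1 * Q t \<omega>"
        using C Q by (intro mult_right_mono mult_left_mono) auto
      moreover have "h_fun \<Sigma> L = (a + b) * L"
        using bL unfolding h_fun_def a_def[symmetric] by (simp add: algebra_simps)
      ultimately show ?thesis
        by (simp add: algebra_simps)
    qed
    have "emeasure M (space M - ?A) \<le> emeasure M {\<omega> \<in> space M. \<not> (\<forall>t. norm (S t \<omega>)
        < 2 * C * (a + b) * (2 * L + 3/4 * Q t \<omega>))}"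
    proof (rule emeasure_mono)
      show "space M - ?A \<subseteq> {\<omega> \<in> space M. \<not> (\<forall>t. norm (S t \<omega>) < 2 * C * (a + b) * (2 * L + 3/4 * Q t \<omega>))}"
        using R by (auto simp: not_le) (meson less_le_trans less_asym)
    qed measurable
    also have "\<dots> \<le> ennreal (2 * exp (- L))"
      unfolding S_def Q_def using assms(8,9) L(2) a_def b_def \<open>0 < a\<close>
      by (rule time_uniform_deviation)
    also have "2 * exp (- L) = \<alpha>"
      using \<alpha> by (simp add: L_def exp_minus)
    finally have "measure M (space M - ?A) \<le> \<alpha>"
      using \<alpha> by (simp add: emeasure_eq_measure)
    then show ?thesis
      using prob_compl[OF A] by linarith
  qed
  also have "?A = {\<omega> \<in> space M. \<forall>t\<ge>1.
           norm ((\<Sum>i=1..t. lam i \<omega> *\<^sub>R X i \<omega>) /\<^sub>R (\<Sum>i=1..t. lam i \<omega>) - \<mu>)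
           \<le> (2 * C * h_fun \<Sigma> 1 * (\<Sum>i=1..t. (lam i \<omega>)\<^sup>2) + 4 * C * h_fun \<Sigma> (ln (2 / \<alpha>)))
               / (\<Sum>i=1..t. lam i \<omega>)}"
  proof (intro Collect_cong conj_cong refl all_cong1 imp_cong)
    fix t :: nat and \<omega>
    assume "\<omega> \<in> space M" "1 \<le> t"
    let ?l = "\<Sum>i=1..t. lam i \<omega>"
    \<comment> \<open>For \<open>t \<ge> 1\<close> the sum of positive weights is nonempty, so
      multiplying through by it preserves the inequality.\<close>
    have l: "0 < ?l"
      using \<open>1 \<le> t\<close> assms(9)[OF _ \<open>\<omega> \<in> space M\<close>] by (intro sum_pos) auto
    have "S t \<omega> = (\<Sum>i=1..t. lam i \<omega> *\<^sub>R X i \<omega>) - ?l *\<^sub>R \<mu>"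
      by (simp add: S_def scaleR_diff_right sum_subtractf scaleR_sum_left)
    then have "(\<Sum>i=1..t. lam i \<omega> *\<^sub>R X i \<omega>) /\<^sub>R ?l - \<mu> = S t \<omega> /\<^sub>R ?l"
      using l by (simp add: scaleR_diff_right)
    then have "norm ((\<Sum>i=1..t. lam i \<omega> *\<^sub>R X i \<omega>) /\<^sub>R ?l - \<mu>) = norm (S t \<omega>) / ?l"
      using l by (simp add: divide_inverse mult.commute)
    then show "norm (S t \<omega>) \<le> ?R t \<omega> \<longleftrightarrow>
        norm ((\<Sum>i=1..t. lam i \<omega> *\<^sub>R X i \<omega>) /\<^sub>R ?l - \<mu>)
          \<le> (2 * C * h_fun \<Sigma> 1 * (\<Sum>i=1..t. (lam i \<omega>)\<^sup>2) + 4 * C * h_fun \<Sigma> (ln (2 / \<alpha>))) / ?l"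
      using l by (simp add: Q_def L_def divide_le_cancel)
  qed
  finally show ?thesis .
qed

end
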